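(* Let $n\ge 3$ and let $\Psi:\mathcal{S}^n\to\mathcal{S}^n$ be a nontrivial radial Blaschke Minkowski homomorphism. If $K,L\in\mathcal{S}^n$, then $$V(\Psi(K\,\tilde{+}\,L))^{\frac{1}{n(n-1)}}\le V(\Psi K)^{\frac{1}{n(n-1)}}+V(\Psi L)^{\frac{1}{n(n-1)}},$$ with equality if and only if $K$ and $L$ are dilates.
   Context: $\mathcal{S}^n$ is the space of star bodies in $\mathbb{R}^n$, i.e. compact sets $L$, starshaped with respect to the origin, whose radial function $\rho(L,u)=\max\{\lambda\ge 0:\lambda u\in L\}$, $u\in S^{n-1}$, is continuous. $\mathcal{S}^n$ is endowed with the Hausdorff topology. $V$ is volume. $K$ and $L$ are dilates if $K=\lambda L$ for some $\lambda>0$. The radial Minkowski sum is defined by $\rho(K\,\tilde{+}\,L,\cdot)=\rho(K,\cdot)+\rho(L,\cdot)$, and the radial Blaschke sum by $\rho^{n-1}(K\,\tilde{\#}\,L,\cdot)=\rho^{n-1}(K,\cdot)+\rho^{n-1}(L,\cdot)$. A radial Blaschke Minkowski homomorphism is a map $\Psi:\mathcal{S}^n\to\mathcal{S}^n$ such that (a) $\Psi$ is continuous; (b) $\Psi(K\,\tilde{\#}\,L)=\Psi K\,\tilde{+}\,\Psi L$ for all $K,L\in\mathcal{S}^n$; (c) $\Psi$ intertwines rotations, i.e. $\Psi(\vartheta L)=\vartheta\Psi L$ for all $L\in\mathcal{S}^n$ and all $\vartheta\in SO(n)$. The trivial one is the operator that maps every star body to the origin.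
   Formalization: The equality condition is corrected to "K and L are dilates, or K = {0}, or L = {0}": when exactly one of the star bodies is the origin, equality holds although K and L are not dilates with λ > 0. *)

theory Defs
  imports "HOL-Analysis.Analysis"
begin

section \<open>Star bodies\<close>

text \<open>The supremum below is attained, hence a maximum, whenever \<open>L\<close> is compact,
  \<open>0 \<in> L\<close> and \<open>u \<noteq> 0\<close>.\<close>

definition radial_function :: "(real^'n) set \<Rightarrow> real^'n \<Rightarrow> real" where
  "radial_function L u = Sup {c. 0 \<le> c \<and> c *\<^sub>R u \<in> L}"

text \<open>The radial function of a star body may vanish; in particular \<open>{0}\<close> is a star body.\<close>

definition star_bodies :: "(real^'n) set set" where
  "star_bodies = {L. compact L \<and> 0 \<in> L \<and> (\<forall>x\<in>L. closed_segment 0 x \<subseteq> L) \<and>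
     continuous_on (sphere 0 1) (radial_function L)}"

definition dilates :: "(real^'n) set \<Rightarrow> (real^'n) set \<Rightarrow> bool" where
  "dilates K L \<longleftrightarrow> (\<exists>c>0. K = (*\<^sub>R) c ` L)"

text \<open>The star body with prescribed radial function \<open>f\<close>; see \<open>star_of_in_star_bodies\<close> and
  \<open>radial_function_star_of\<close>.\<close>

definition star_of :: "(real^'n \<Rightarrow> real) \<Rightarrow> (real^'n) set" where
  "star_of f = {r *\<^sub>R u | r u. u \<in> sphere 0 1 \<and> 0 \<le> r \<and> r \<le> f u}"

definition radial_minkowski_sum :: "(real^'n) set \<Rightarrow> (real^'n) set \<Rightarrow> (real^'n) set" where
  "radial_minkowski_sum K L = star_of (\<lambda>u. radial_function K u + radial_function L u)"

definition radial_blaschke_sum :: "(real^'n) set \<Rightarrow> (real^'n) set \<Rightarrow> (real^'n) set" where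
  "radial_blaschke_sum K L = star_of (\<lambda>u. root (CARD('n) - 1)
     (radial_function K u ^ (CARD('n) - 1) + radial_function L u ^ (CARD('n) - 1)))"

lemma radial_function_star_of:
  fixes f :: "real^'n \<Rightarrow> real"
  assumes f: "\<And>u. u \<in> sphere 0 1 \<Longrightarrow> 0 \<le> f u" and u: "u \<in> sphere 0 1"
  shows "radial_function (star_of f) u = f u"
proof -
  have "{c. 0 \<le> c \<and> c *\<^sub>R u \<in> star_of f} = {0..f u}"
  proof (intro set_eqI iffI)
    fix c assume "c \<in> {c. 0 \<le> c \<and> c *\<^sub>R u \<in> star_of f}"
    then obtain r v where c: "0 \<le> c" and v: "norm v = 1" "0 \<le> r" "r \<le> f v"
      and eq: "c *\<^sub>R u = r *\<^sub>R v"
      by (auto simp: star_of_def)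
    from arg_cong[OF eq, of norm] have "c = r" using u v c by simp
    then show "c \<in> {0..f u}"
      using eq v c f[OF u] by (cases "r = 0") auto
  next
    fix c assume "c \<in> {0..f u}"
    then show "c \<in> {c. 0 \<le> c \<and> c *\<^sub>R u \<in> star_of f}"
      using u by (auto simp: star_of_def)
  qed
  then show ?thesis
    using f[OF u] by (simp add: radial_function_def)
qed

lemma star_of_in_star_bodies:
  fixes f :: "real^'n \<Rightarrow> real"
  assumes f: "\<And>u. u \<in> sphere 0 1 \<Longrightarrow> 0 \<le> f u" and cont: "continuous_on (sphere 0 1) f"
  shows "star_of f \<in> star_bodies"
proof -
  have eq: "star_of f = (\<lambda>(t, u). (t * f u) *\<^sub>R u) ` ({0..1} \<times> sphere 0 1)"
  proof (intro set_eqI iffI)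
    fix x assume "x \<in> star_of f"
    then obtain r u where x: "x = r *\<^sub>R u" "u \<in> sphere 0 1" "0 \<le> r" "r \<le> f u"
      by (auto simp: star_of_def)
    show "x \<in> (\<lambda>(t, u). (t * f u) *\<^sub>R u) ` ({0..1} \<times> sphere 0 1)"
    proof (rule image_eqI)
      show "x = (\<lambda>(t, u). (t * f u) *\<^sub>R u) (r / f u, u)"
        using x by (cases "f u = 0") auto
      show "(r / f u, u) \<in> {0..1} \<times> sphere 0 1"
        using x f[OF x(2)] by (auto simp: divide_le_eq_1)
    qed
  next
    fix x assume "x \<in> (\<lambda>(t, u). (t * f u) *\<^sub>R u) ` ({0..1} \<times> sphere 0 1)"
    then obtain t u where x: "x = (t * f u) *\<^sub>R u" "u \<in> sphere 0 1" "0 \<le> t" "t \<le> 1"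
      by auto
    then have "0 \<le> t * f u" "t * f u \<le> f u"
      using f[OF x(2)] by (auto intro: mult_left_le_one_le)
    then show "x \<in> star_of f"
      using x by (auto simp: star_of_def)
  qed
  have "compact (star_of f)"
    unfolding eq split_def
    by (intro compact_continuous_image continuous_intros compact_Times compact_sphere
        continuous_on_compose2[OF cont]) auto
  moreover have "0 \<in> star_of f"
  proof -
    obtain u :: "real^'n" where "norm u = 1"
      using vector_choose_size[of 1] by auto
    then show ?thesis
      using f[of u] unfolding star_of_def by (intro CollectI exI[of _ 0] exI[of _ u]) simp
  qed
  moreover have "closed_segment 0 x \<subseteq> star_of f" if x_in: "x \<in> star_of f" for x
  proof
    fix y assume "y \<in> closed_segment 0 x"
    then obtain t where t: "0 \<le> t" "t \<le> 1" "y = t *\<^sub>R x"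
      by (auto simp: in_segment)
    obtain r u where x: "x = r *\<^sub>R u" "norm u = 1" "0 \<le> r" "r \<le> f u"
      using x_in unfolding star_of_def mem_Collect_eq mem_sphere_0 by blast
    have "t * r \<le> f u" "0 \<le> t * r"
      using mult_left_le_one_le[of r t] t x by auto
    then show "y \<in> star_of f"
      using t x unfolding star_of_def
      by (intro CollectI exI[of _ "t * r"] exI[of _ u]) simp
  qed
  moreover have "continuous_on (sphere 0 1) (radial_function (star_of f))"
    using cont by (rule continuous_on_eq) (simp only: radial_function_star_of f)
  ultimately show ?thesis
    by (auto simp: star_bodies_def)
qed

lemma radial_function_nonneg:
  assumes "L \<in> star_bodies" "u \<in> sphere 0 1"
  shows "0 \<le> radial_function L u"
proof -
  obtain B where B: "\<And>x. x \<in> L \<Longrightarrow> norm x \<le> B"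
    using assms(1) compact_imp_bounded[of L] unfolding star_bodies_def bounded_iff by blast
  have "bdd_above {c. 0 \<le> c \<and> c *\<^sub>R u \<in> L}"
  proof (rule bdd_aboveI[of _ B])
    fix c assume c: "c \<in> {c. 0 \<le> c \<and> c *\<^sub>R u \<in> L}"
    then have "norm (c *\<^sub>R u) \<le> B" using B by blast
    then show "c \<le> B" using c assms(2) by simp
  qed
  then show ?thesis
    unfolding radial_function_def
    using assms by (intro cSup_upper) (auto simp: star_bodies_def)
qed

lemma radial_minkowski_sum:
  assumes K: "K \<in> star_bodies" and L: "L \<in> star_bodies"
  shows "radial_minkowski_sum K L \<in> star_bodies"
    and "u \<in> sphere 0 1 \<Longrightarrow>
      radial_function (radial_minkowski_sum K L) u = radial_function K u + radial_function L u"
proof -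
  let ?f = "\<lambda>v. radial_function K v + radial_function L v"
  have nonneg: "0 \<le> radial_function K v + radial_function L v" if "v \<in> sphere 0 1" for v
    using radial_function_nonneg[OF K that] radial_function_nonneg[OF L that] by simp
  have cont: "continuous_on (sphere 0 1) ?f"
    using K L by (intro continuous_on_add) (auto simp: star_bodies_def)
  show "radial_minkowski_sum K L \<in> star_bodies"
    and "u \<in> sphere 0 1 \<Longrightarrow>
      radial_function (radial_minkowski_sum K L) u = radial_function K u + radial_function L u"
    unfolding radial_minkowski_sum_def
    using star_of_in_star_bodies[of ?f, OF nonneg cont] radial_function_star_of[of ?f, OF nonneg]
    by blast+
qed

lemma radial_blaschke_sum:
  fixes K L :: "(real^'n) set"
  assumes K: "K \<in> star_bodies" and L: "L \<in> star_bodies" and n: "CARD('n) \<ge> 2"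
  shows "radial_blaschke_sum K L \<in> star_bodies"
    and "u \<in> sphere 0 1 \<Longrightarrow>
      radial_function (radial_blaschke_sum K L) u ^ (CARD('n) - 1) =
        radial_function K u ^ (CARD('n) - 1) + radial_function L u ^ (CARD('n) - 1)"
proof -
  let ?g = "\<lambda>v. radial_function K v ^ (CARD('n) - 1) + radial_function L v ^ (CARD('n) - 1)"
  have g: "0 \<le> ?g v" if "v \<in> sphere 0 1" for v
    using radial_function_nonneg[OF K that] radial_function_nonneg[OF L that] by simp
  have nonneg: "0 \<le> root (CARD('n) - 1) (?g v)" if "v \<in> sphere 0 1" for v
    using g[OF that] by (rule real_root_ge_zero)
  have cont: "continuous_on (sphere 0 1) (\<lambda>v. root (CARD('n) - 1) (?g v))"
    using K L by (intro continuous_on_real_root continuous_on_add continuous_on_power)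
      (auto simp: star_bodies_def)
  show "radial_blaschke_sum K L \<in> star_bodies"
    and "u \<in> sphere 0 1 \<Longrightarrow> radial_function (radial_blaschke_sum K L) u ^ (CARD('n) - 1) = ?g u"
    using star_of_in_star_bodies[of "\<lambda>v. root (CARD('n) - 1) (?g v)", OF nonneg cont]
      radial_function_star_of[of "\<lambda>v. root (CARD('n) - 1) (?g v)" u, OF nonneg]
      real_root_pow_pos2[of "CARD('n) - 1" "?g u", OF _ g] n
    unfolding radial_blaschke_sum_def by simp_all
qed


section \<open>The Hausdorff topology\<close>

text \<open>The value \<open>0\<close> for empty or unbounded sets is a convention; star bodies are
  nonempty and bounded.\<close>

definition hausdorff_dist :: "'a::metric_space set \<Rightarrow> 'a set \<Rightarrow> real" where
  "hausdorff_dist K L =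
     (if K = {} \<or> L = {} \<or> \<not> bounded K \<or> \<not> bounded L then 0
      else max (SUP x\<in>K. infdist x L) (SUP y\<in>L. infdist y K))"

definition star_body_topology :: "(real^'n) set topology" where
  "star_body_topology = Metric_space.mtopology star_bodies hausdorff_dist"

lemma bdd_above_infdist:
  assumes "bounded K"
  shows "bdd_above ((\<lambda>x. infdist x L) ` K)"
proof (cases "K = {}")
  case False
  then obtain a where "a \<in> K" by auto
  obtain e where e: "\<And>x. x \<in> K \<Longrightarrow> dist a x \<le> e"
    using assms bounded_any_center[of K a] by auto
  have "infdist x L \<le> infdist a L + e" if "x \<in> K" for x
    using infdist_triangle[of x L a] e[OF that] by (simp add: dist_commute)
  then show ?thesis by (intro bdd_aboveI2)
qed auto

lemma hausdorff_dist_nonneg: "0 \<le> hausdorff_dist K L"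
proof (cases "K = {} \<or> L = {} \<or> \<not> bounded K \<or> \<not> bounded L")
  case False
  then obtain a where "a \<in> K" by auto
  then have "infdist a L \<le> (SUP x\<in>K. infdist x L)"
    using False by (intro cSUP_upper bdd_above_infdist) auto
  then show ?thesis
    using False infdist_nonneg[of a L] by (simp add: hausdorff_dist_def le_max_iff_disj)
qed (simp add: hausdorff_dist_def)

lemma hausdorff_dist_commute: "hausdorff_dist K L = hausdorff_dist L K"
  by (auto simp: hausdorff_dist_def max.commute)

lemma hausdorff_dist_le_iff:
  assumes "K \<noteq> {}" "L \<noteq> {}" "bounded K" "bounded L"
  shows "hausdorff_dist K L \<le> e \<longleftrightarrow> (\<forall>x\<in>K. infdist x L \<le> e) \<and> (\<forall>y\<in>L. infdist y K \<le> e)"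
  using assms by (simp add: hausdorff_dist_def cSUP_le_iff bdd_above_infdist)

lemma Metric_space_hausdorff_dist:
  "Metric_space {K::'a::heine_borel set. compact K \<and> K \<noteq> {}} hausdorff_dist"
proof
  fix K L M :: "'a set"
  assume "K \<in> {K. compact K \<and> K \<noteq> {}}" "L \<in> {K. compact K \<and> K \<noteq> {}}"
  then have K: "K \<noteq> {}" "compact K" "closed K" "bounded K"
    and L: "L \<noteq> {}" "compact L" "closed L" "bounded L"
    by (auto simp: compact_imp_closed compact_imp_bounded)
  have "infdist x A \<le> 0 \<longleftrightarrow> x \<in> A" if "closed A" "A \<noteq> {}" for x and A :: "'a set"
    using in_closed_iff_infdist_zero[OF that, of x] infdist_nonneg[of x A] by linarith
  then have le: "hausdorff_dist K L \<le> 0 \<longleftrightarrow> K = L"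
    unfolding hausdorff_dist_le_iff[OF K(1) L(1) K(4) L(4)] using K L by blast
  then show "hausdorff_dist K L = 0 \<longleftrightarrow> K = L"
    using hausdorff_dist_nonneg[of K L] by auto
  assume "M \<in> {K. compact K \<and> K \<noteq> {}}"
  then have M: "M \<noteq> {}" "compact M" "closed M" "bounded M"
    by (auto simp: compact_imp_closed compact_imp_bounded)
  have half: "infdist x C \<le> hausdorff_dist A B + hausdorff_dist B C"
    if A: "x \<in> A" "A \<noteq> {}" "bounded A" and B: "B \<noteq> {}" "closed B" "bounded B"
      and C: "C \<noteq> {}" "bounded C" for x and A B C :: "'a set"
  proof -
    obtain y where y: "y \<in> B" "infdist x B = dist x y"
      using infdist_attains_inf[OF B(2,1)] by metis
    have "infdist x B \<le> hausdorff_dist A B"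
      using hausdorff_dist_le_iff[OF A(2) B(1) A(3) B(3), of "hausdorff_dist A B"] A(1) by simp
    moreover have "infdist y C \<le> hausdorff_dist B C"
      using hausdorff_dist_le_iff[OF B(1) C(1) B(3) C(2), of "hausdorff_dist B C"] y(1) by simp
    ultimately show ?thesis
      using infdist_triangle[of x C y] y by simp
  qed
  show "hausdorff_dist K M \<le> hausdorff_dist K L + hausdorff_dist L M"
    unfolding hausdorff_dist_le_iff[OF K(1) M(1) K(4) M(4)]
  proof (intro conjI ballI)
    show "infdist x M \<le> hausdorff_dist K L + hausdorff_dist L M" if "x \<in> K" for x
      using that K(1,4) L(1,3,4) M(1,4) by (rule half)
    have "infdist y K \<le> hausdorff_dist M L + hausdorff_dist L K" if "y \<in> M" for y
      using that M(1,4) L(1,3,4) K(1,4) by (rule half)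
    then show "infdist y K \<le> hausdorff_dist K L + hausdorff_dist L M" if "y \<in> M" for y
      using that by (simp add: hausdorff_dist_commute[of M L] hausdorff_dist_commute[of L K]
          add.commute)
  qed
qed (rule hausdorff_dist_nonneg, rule hausdorff_dist_commute)

lemma Metric_space_star_bodies: "Metric_space star_bodies hausdorff_dist"
  by (rule Metric_space.subspace[OF Metric_space_hausdorff_dist]) (auto simp: star_bodies_def)

lemma topspace_star_body_topology: "topspace star_body_topology = star_bodies"
  by (simp add: star_body_topology_def Metric_space.topspace_mtopology[OF Metric_space_star_bodies])


section \<open>Radial Blaschke Minkowski homomorphisms\<close>

text \<open>Rotations in SO(n) are given by matrices satisfying \<open>rotation_matrix\<close>. Only the values
  of \<open>\<Psi>\<close> on \<open>star_bodies\<close> matter.\<close>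

definition radial_blaschke_minkowski_hom ::
  "((real^'n) set \<Rightarrow> (real^'n) set) \<Rightarrow> bool" where
  "radial_blaschke_minkowski_hom \<Psi> \<longleftrightarrow>
     \<Psi> \<in> star_bodies \<rightarrow> star_bodies \<and>
     continuous_map star_body_topology star_body_topology \<Psi> \<and>
     (\<forall>K\<in>star_bodies. \<forall>L\<in>star_bodies.
        \<Psi> (radial_blaschke_sum K L) = radial_minkowski_sum (\<Psi> K) (\<Psi> L)) \<and>
     (\<forall>L\<in>star_bodies. \<forall>A::real^'n^'n. rotation_matrix A \<longrightarrow>
        \<Psi> ((*v) A ` L) = (*v) A ` \<Psi> L)"

definition trivial_hom :: "((real^'n) set \<Rightarrow> (real^'n) set) \<Rightarrow> bool" where
  "trivial_hom \<Psi> \<longleftrightarrow> (\<forall>L\<in>star_bodies. \<Psi> L = {0})"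

end

theory Submission
  imports Defs
begin

text \<open>In terms of \<open>f = \<rho>(L)^(n-1)\<close>, the map \<open>\<Psi>\<close> becomes an additive map \<open>\<Phi>\<close> on the nonnegative
  continuous functions on the sphere, and each \<open>f \<mapsto> \<Phi> f u\<close> is a positive functional. Minkowski's
  inequality in \<open>L^(n-1)\<close> of this functional gives
  \<open>\<rho>(\<Psi>(K + L))^(1/(n-1)) \<le> \<rho>(\<Psi> K)^(1/(n-1)) + \<rho>(\<Psi> L)^(1/(n-1))\<close> in every direction, and Minkowski's
  inequality in \<open>L^(n(n-1))\<close> of the sphere then gives the claim, because the volume of a star body
  integrates the \<open>n\<close>-th power of its radial function. In the case of equality the convexity gap
  in the first inequality is a nonnegative continuous function annihilated by \<open>\<Phi>\<close>; rotation
  equivariance and compactness of the sphere show that such a function vanishes.\<close>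


section \<open>Positive functionals on nonnegative continuous functions\<close>

text \<open>The induction step rests on an identity: \<open>a * s ^ Suc p + b * t ^ Suc p\<close>
  exceeds \<open>(a * s + b * t) * (a * s ^ p + b * t ^ p)\<close> by
  \<open>a * b * (s ^ p - t ^ p) * (s - t)\<close>, where the two differences never have opposite
  signs.\<close>

lemma power_convex_combination:
  fixes s t :: real
  assumes "0 \<le> a" "0 \<le> b" "a + b = 1" "0 \<le> s" "0 \<le> t" "0 < p"
  shows "(a * s + b * t) ^ p \<le> a * s ^ p + b * t ^ p"
  using \<open>0 < p\<close>
proof (induction p rule: nat_induct_non_zero)
  case (Suc p)
  have "0 \<le> (s ^ p - t ^ p) * (s - t)"
    using assms power_mono[of s t p] power_mono[of t s p]
    by (cases "s \<le> t") (auto intro: mult_nonneg_nonneg mult_nonpos_nonpos)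
  then have "0 \<le> (a * b) * ((s ^ p - t ^ p) * (s - t))"
    using assms by simp
  also have "\<dots> = a * s ^ Suc p + b * t ^ Suc p - (a * s + b * t) * (a * s ^ p + b * t ^ p)"
  proof -
    have b: "b = 1 - a" using assms by simp
    show ?thesis unfolding b by (simp add: algebra_simps)
  qed
  finally have "(a * s + b * t) * (a * s ^ p + b * t ^ p) \<le> a * s ^ Suc p + b * t ^ Suc p"
    by simp
  moreover have "(a * s + b * t) * (a * s + b * t) ^ p \<le> (a * s + b * t) * (a * s ^ p + b * t ^ p)"
    using Suc.IH assms by (intro mult_left_mono) auto
  ultimately show ?case by simp
qed simp

text \<open>The same identity for the exponent \<open>q = p - 1\<close>: as \<open>q\<close> is
  positive, both differences are nonzero when \<open>s \<noteq> t\<close>, so the inequality is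
  strict.\<close>

lemma power_convex_combination_eqD:
  fixes s t :: real
  assumes "0 < a" "0 < b" "a + b = 1" "0 \<le> s" "0 \<le> t" "2 \<le> p"
    and eq: "(a * s + b * t) ^ p = a * s ^ p + b * t ^ p"
  shows "s = t"
proof (rule ccontr)
  assume "s \<noteq> t"
  obtain q where p: "p = Suc q" "0 < q"
    using \<open>2 \<le> p\<close> by (cases p) auto
  have "0 < (s ^ q - t ^ q) * (s - t)"
    using assms p \<open>s \<noteq> t\<close> power_strict_mono[of s t q] power_strict_mono[of t s q]
    by (cases "s < t") (auto intro: mult_pos_pos mult_neg_neg)
  then have "0 < (a * b) * ((s ^ q - t ^ q) * (s - t))"
    using assms by simp
  also have "\<dots> = a * s ^ p + b * t ^ p - (a * s + b * t) * (a * s ^ q + b * t ^ q)"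
  proof -
    have b: "b = 1 - a" using assms by simp
    show ?thesis unfolding b p by (simp add: algebra_simps)
  qed
  also have "(a * s + b * t) * (a * s + b * t) ^ q \<le> (a * s + b * t) * (a * s ^ q + b * t ^ q)"
    using power_convex_combination[of a b s t q] assms p by (intro mult_left_mono) auto
  then have "a * s ^ p + b * t ^ p - (a * s + b * t) * (a * s ^ q + b * t ^ q)
     \<le> a * s ^ p + b * t ^ p - (a * s + b * t) ^ p"
    using p by simp
  finally show False using eq by simp
qed

text \<open>Nonnegativity makes \<open>\<phi>\<close> monotone. Bracketing \<open>m * c\<close>
  between consecutive integers bounds \<open>m\<close> times the error by \<open>\<phi> 1\<close>
  for every \<open>m\<close>, so the error is zero.\<close>

lemma additive_nonneg_real_imp_linear:
  fixes \<phi> :: "real \<Rightarrow> real"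
  assumes add: "\<And>x y. 0 \<le> x \<Longrightarrow> 0 \<le> y \<Longrightarrow> \<phi> (x + y) = \<phi> x + \<phi> y"
    and nonneg: "\<And>x. 0 \<le> x \<Longrightarrow> 0 \<le> \<phi> x" and c: "0 \<le> c"
  shows "\<phi> c = c * \<phi> 1"
proof -
  have mult: "\<phi> (real m * x) = real m * \<phi> x" if "0 \<le> x" for m x
  proof (induction m)
    case 0
    show ?case using add[of 0 0] by simp
  next
    case (Suc m)
    then show ?case using add[of x "real m * x"] that by (simp add: algebra_simps)
  qed
  have mono: "\<phi> x \<le> \<phi> y" if "0 \<le> x" "x \<le> y" for x y
    using add[of x "y - x"] nonneg[of "y - x"] that by simp
  have "real m * \<bar>\<phi> c - c * \<phi> 1\<bar> \<le> \<phi> 1" for m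
  proof -
    define k where "k = nat \<lfloor>real m * c\<rfloor>"
    have k: "real k \<le> real m * c" "real m * c \<le> real (Suc k)"
      using c unfolding k_def by (auto simp: of_nat_nat) linarith
    have "real k * \<phi> 1 \<le> real m * \<phi> c" "real m * \<phi> c \<le> real (Suc k) * \<phi> 1"
      using mono[OF _ k(1)] mono[OF _ k(2)] mult[OF c, of m] mult[of 1 k] mult[of 1 "Suc k"] c
      by auto
    moreover have "real k * \<phi> 1 \<le> (real m * c) * \<phi> 1" "(real m * c) * \<phi> 1 \<le> real (Suc k) * \<phi> 1"
      using k nonneg[of 1] by (auto intro!: mult_right_mono)
    ultimately have "\<bar>real m * \<phi> c - real m * c * \<phi> 1\<bar> \<le> \<phi> 1"
      by (simp add: algebra_simps abs_le_iff)
    also have "real m * \<phi> c - real m * c * \<phi> 1 = real m * (\<phi> c - c * \<phi> 1)"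
      by (simp add: algebra_simps)
    finally show ?thesis by (simp add: abs_mult)
  qed
  then show ?thesis
    using reals_Archimedean3[of "\<bar>\<phi> c - c * \<phi> 1\<bar>"]
    by (metis abs_ge_zero eq_iff_diff_eq_0 not_less zero_less_abs_iff)
qed

section \<open>The cone of nonnegative continuous functions and the convexity gap\<close>

definition nonneg_continuous :: "'a::topological_space set \<Rightarrow> ('a \<Rightarrow> real) set" where
  "nonneg_continuous X = {f. continuous_on X f \<and> (\<forall>x\<in>X. 0 \<le> f x)}"

lemma nonneg_continuousI [intro?]:
  "continuous_on X f \<Longrightarrow> (\<And>x. x \<in> X \<Longrightarrow> 0 \<le> f x) \<Longrightarrow> f \<in> nonneg_continuous X"
  by (simp add: nonneg_continuous_def)

lemma nonneg_continuous_closed [simp, intro]: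
  assumes "f \<in> nonneg_continuous X"
  shows "(\<lambda>x. f x ^ p) \<in> nonneg_continuous X"
    and "0 \<le> c \<Longrightarrow> (\<lambda>x. c * f x) \<in> nonneg_continuous X"
    and "(\<lambda>x. root p (f x)) \<in> nonneg_continuous X"
    and "g \<in> nonneg_continuous X \<Longrightarrow> (\<lambda>x. f x + g x) \<in> nonneg_continuous X"
  using assms by (auto simp: nonneg_continuous_def intro!: continuous_intros real_root_ge_zero)

lemma nonneg_continuous_const [simp, intro]:
  "0 \<le> c \<Longrightarrow> (\<lambda>x. c) \<in> nonneg_continuous X"
  by (simp add: nonneg_continuous_def)

lemma nonneg_continuousD:
  assumes "f \<in> nonneg_continuous X"
  shows "continuous_on X f" and "x \<in> X \<Longrightarrow> 0 \<le> f x"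
  using assms by (auto simp: nonneg_continuous_def)

text \<open>The defect in Jensen's inequality for the \<open>p\<close>-th power at the points
  \<open>x / a\<close> and \<open>y / b\<close> with weights proportional to \<open>a\<close> and
  \<open>b\<close>; their weighted mean is \<open>(x + y) / (a + b)\<close>.\<close>

definition convexity_gap :: "real \<Rightarrow> real \<Rightarrow> nat \<Rightarrow> real \<Rightarrow> real \<Rightarrow> real" where
  "convexity_gap a b p x y =
     a / (a + b) * (x / a) ^ p + b / (a + b) * (y / b) ^ p - ((x + y) / (a + b)) ^ p"

lemma convexity_gap:
  assumes "0 < a" "0 < b" "0 \<le> x" "0 \<le> y"
  shows "0 < p \<Longrightarrow> 0 \<le> convexity_gap a b p x y"
    and "2 \<le> p \<Longrightarrow> convexity_gap a b p x y = 0 \<Longrightarrow> x / a = y / b"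
proof -
  have 1: "a / (a + b) + b / (a + b) = 1"
    using assms by (simp flip: add_divide_distrib)
  have "a / (a + b) * (x / a) = x / (a + b)" "b / (a + b) * (y / b) = y / (a + b)"
    using assms by simp_all
  then have 2: "(x + y) / (a + b) = a / (a + b) * (x / a) + b / (a + b) * (y / b)"
    by (simp only: add_divide_distrib)
  show "0 < p \<Longrightarrow> 0 \<le> convexity_gap a b p x y"
    using power_convex_combination[OF _ _ 1, of "x / a" "y / b" p] assms
    unfolding convexity_gap_def 2 by simp
  show "2 \<le> p \<Longrightarrow> convexity_gap a b p x y = 0 \<Longrightarrow> x / a = y / b"
    using power_convex_combination_eqD[OF _ _ 1, of "x / a" "y / b" p] assms
    unfolding convexity_gap_def 2 by simp
qed

lemma convexity_gap_nonneg_continuous: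
  assumes f: "f \<in> nonneg_continuous X" and g: "g \<in> nonneg_continuous X"
    and "0 < a" "0 < b" "0 < p"
  shows "(\<lambda>x. convexity_gap a b p (f x) (g x)) \<in> nonneg_continuous X"
proof
  show "continuous_on X (\<lambda>x. convexity_gap a b p (f x) (g x))"
    using nonneg_continuousD(1)[OF f] nonneg_continuousD(1)[OF g] assms(3-5)
    unfolding convexity_gap_def by (intro continuous_intros) auto
qed (use nonneg_continuousD(2)[OF f] nonneg_continuousD(2)[OF g] assms convexity_gap(1) in auto)

section \<open>Minkowski's inequality for positive functionals\<close>

text \<open>Covers both the integral over the sphere and the functionals
  \<open>f \<mapsto> \<Phi> f u\<close>.\<close>

locale positive_functional =
  fixes X :: "'a::topological_space set" and T :: "('a \<Rightarrow> real) \<Rightarrow> real"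
  assumes add: "\<lbrakk>f \<in> nonneg_continuous X; g \<in> nonneg_continuous X\<rbrakk> \<Longrightarrow>
      T (\<lambda>x. f x + g x) = T f + T g"
    and nonneg: "f \<in> nonneg_continuous X \<Longrightarrow> 0 \<le> T f"
begin

lemma mono:
  assumes f: "f \<in> nonneg_continuous X" and g: "g \<in> nonneg_continuous X"
    and le: "\<And>x. x \<in> X \<Longrightarrow> f x \<le> g x"
  shows "T f \<le> T g"
proof -
  have d: "(\<lambda>x. g x - f x) \<in> nonneg_continuous X"
    using f g le by (auto simp: nonneg_continuous_def intro!: continuous_on_diff)
  show ?thesis using add[OF f d] nonneg[OF d] by simp
qed

lemma cong:
  assumes "f \<in> nonneg_continuous X" "g \<in> nonneg_continuous X" "\<And>x. x \<in> X \<Longrightarrow> f x = g x"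
  shows "T f = T g"
  using assms by (intro antisym mono) auto

text \<open>For fixed \<open>f\<close>, the map \<open>a \<mapsto> T (\<lambda>x. a * f x)\<close>
  solves Cauchy's equation on the half-line.\<close>

lemma scale:
  assumes f: "f \<in> nonneg_continuous X" and c: "0 \<le> c"
  shows "T (\<lambda>x. c * f x) = c * T f"
proof -
  have "T (\<lambda>x. (a + b) * f x) = T (\<lambda>x. a * f x) + T (\<lambda>x. b * f x)" if "0 \<le> a" "0 \<le> b" for a b
    using add[of "\<lambda>x. a * f x" "\<lambda>x. b * f x"] f that by (simp add: distrib_right)
  then show ?thesis
    using additive_nonneg_real_imp_linear[of "\<lambda>a. T (\<lambda>x. a * f x)" c] f c by (auto intro: nonneg)
qed

lemma convexity_gap_eq:
  assumes f: "f \<in> nonneg_continuous X" and g: "g \<in> nonneg_continuous X"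
    and ab: "0 < a" "0 < b" and p: "0 < p"
  shows "T (\<lambda>x. convexity_gap a b p (f x) (g x)) =
    a / (a + b) * (T (\<lambda>x. f x ^ p) / a ^ p) + b / (a + b) * (T (\<lambda>x. g x ^ p) / b ^ p) -
      T (\<lambda>x. (f x + g x) ^ p) / (a + b) ^ p"
proof -
  let ?u = "\<lambda>x. (a / (a + b) / a ^ p) * f x ^ p" and ?v = "\<lambda>x. (b / (a + b) / b ^ p) * g x ^ p"
    and ?w = "\<lambda>x. (1 / (a + b) ^ p) * (f x + g x) ^ p"
  \<comment> \<open>The subtracted term \<open>?w\<close> is moved to the other side, because
    \<open>T\<close> is additive only within the cone.\<close>
  have "T (\<lambda>x. convexity_gap a b p (f x) (g x)) + T ?w =
      T (\<lambda>x. convexity_gap a b p (f x) (g x) + ?w x)"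
    using assms by (intro add[symmetric] convexity_gap_nonneg_continuous nonneg_continuous_closed) auto
  also have "(\<lambda>x. convexity_gap a b p (f x) (g x) + ?w x) = (\<lambda>x. ?u x + ?v x)"
    by (simp add: convexity_gap_def power_divide)
  also have "T \<dots> = T ?u + T ?v"
    using assms by (intro add nonneg_continuous_closed) auto
  also have "T ?u = a / (a + b) / a ^ p * T (\<lambda>x. f x ^ p)"
    using assms by (intro scale nonneg_continuous_closed) auto
  also have "T ?v = b / (a + b) / b ^ p * T (\<lambda>x. g x ^ p)"
    using assms by (intro scale nonneg_continuous_closed) auto
  also have "T ?w = 1 / (a + b) ^ p * T (\<lambda>x. (f x + g x) ^ p)"
    using assms by (intro scale nonneg_continuous_closed) auto
  finally show ?thesis by simp
qed

text \<open>For positive \<open>a\<close> and \<open>b\<close>, apply \<open>T\<close> to the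
  nonnegative convexity gap: the normalised powers of \<open>f\<close> and \<open>g\<close> have
  values at most 1, hence so has that of the sum.\<close>

lemma minkowski:
  assumes f: "f \<in> nonneg_continuous X" and g: "g \<in> nonneg_continuous X"
    and ab: "0 \<le> a" "0 \<le> b" and p: "0 < p"
    and Tf: "T (\<lambda>x. f x ^ p) \<le> a ^ p" and Tg: "T (\<lambda>x. g x ^ p) \<le> b ^ p"
  shows "T (\<lambda>x. (f x + g x) ^ p) \<le> (a + b) ^ p"
proof -
  \<comment> \<open>The gap divides by the bounds, which may be zero; they are enlarged by
    \<open>e\<close>, and \<open>e\<close> tends to 0 at the end.\<close>
  have le: "T (\<lambda>x. (f x + g x) ^ p) \<le> ((a + e) + (b + e)) ^ p" if e: "0 < e" for e
  proof -
    have pos: "0 < a + e" "0 < b + e" using ab e by auto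
    have "T (\<lambda>x. f x ^ p) \<le> (a + e) ^ p" "T (\<lambda>x. g x ^ p) \<le> (b + e) ^ p"
      using Tf Tg power_mono[of a "a + e" p] power_mono[of b "b + e" p] ab e by auto
    then have le1: "T (\<lambda>x. f x ^ p) / (a + e) ^ p \<le> 1" "T (\<lambda>x. g x ^ p) / (b + e) ^ p \<le> 1"
      using pos by auto
    let ?s = "(a + e) + (b + e)"
    have "0 \<le> T (\<lambda>x. convexity_gap (a + e) (b + e) p (f x) (g x))"
      by (intro nonneg convexity_gap_nonneg_continuous f g pos p)
    then have "T (\<lambda>x. (f x + g x) ^ p) / ?s ^ p \<le>
        (a + e) / ?s * (T (\<lambda>x. f x ^ p) / (a + e) ^ p) + (b + e) / ?s * (T (\<lambda>x. g x ^ p) / (b + e) ^ p)"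
      by (subst (asm) convexity_gap_eq[OF f g pos p]) simp
    also have "\<dots> \<le> (a + e) / ?s * 1 + (b + e) / ?s * 1"
      using pos by (intro add_mono mult_left_mono le1) auto
    also have "\<dots> = 1" using pos by (simp flip: add_divide_distrib)
    finally show ?thesis using pos by (simp add: divide_le_eq_1 zero_less_power)
  qed
  have "((\<lambda>e. ((a + e) + (b + e)) ^ p) \<longlongrightarrow> ((a + 0) + (b + 0)) ^ p) (at_right 0)"
    by (intro tendsto_intros)
  then show ?thesis
    using le by (intro tendsto_lowerbound[where f = "\<lambda>e. ((a + e) + (b + e)) ^ p" and F = "at_right 0"])
      (auto intro: eventually_mono[OF eventually_at_right_less])
qed

text \<open>All three normalised values equal \<open>c ^ p\<close> and cancel. In the application
  \<open>c\<close> carries the dependence on the direction, while \<open>a\<close> and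
  \<open>b\<close> stay fixed.\<close>

lemma minkowski_equality:
  assumes "f \<in> nonneg_continuous X" "g \<in> nonneg_continuous X"
    and ab: "0 < a" "0 < b" and p: "0 < p"
    and "T (\<lambda>x. f x ^ p) = (a * c) ^ p" "T (\<lambda>x. g x ^ p) = (b * c) ^ p"
    and "T (\<lambda>x. (f x + g x) ^ p) = ((a + b) * c) ^ p"
  shows "T (\<lambda>x. convexity_gap a b p (f x) (g x)) = 0"
proof -
  have "a / (a + b) * c ^ p + b / (a + b) * c ^ p = c ^ p"
    using ab by (simp add: distrib_right[symmetric] add_divide_distrib[symmetric])
  then show ?thesis
    using ab by (subst convexity_gap_eq) (simp_all add: assms power_mult_distrib)
qed

end


section \<open>Volume in polar coordinates\<close>

lemma nn_integral_lborel_scale: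
  fixes g :: "'a::euclidean_space \<Rightarrow> ennreal"
  assumes [measurable]: "g \<in> borel_measurable borel" and c: "0 < c"
  shows "(\<integral>\<^sup>+x. g x \<partial>lborel) = ennreal (c ^ DIM('a)) * (\<integral>\<^sup>+x. g (c *\<^sub>R x) \<partial>lborel)"
  using c by (subst lborel_affine[of c 0]) (simp_all add: nn_integral_density nn_integral_distr nn_integral_cmult)

lemma nn_integral_power_Ioc:
  assumes "0 \<le> c" "0 < N"
  shows "(\<integral>\<^sup>+t. ennreal (real N * t ^ (N - 1)) * indicator {0<..c} t \<partial>lborel) = ennreal (c ^ N)"
proof -
  have "(\<integral>\<^sup>+t. ennreal (real N * t ^ (N - 1)) * indicator {0<..c} t \<partial>lborel) =
     (\<integral>\<^sup>+t. ennreal (real N * t ^ (N - 1)) * indicator {0..c} t \<partial>lborel)"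
    by (intro nn_integral_cong_AE AE_I[of _ _ "{0}"]) (auto simp: indicator_def)
  also have "\<dots> = ennreal (c ^ N - 0 ^ N)"
    using assms by (intro nn_integral_FTC_Icc) (auto intro!: derivative_eq_intros)
  finally show ?thesis using assms by simp
qed

text \<open>Both sides equal the integral of \<open>N / t\<close> over the pairs \<open>(x, t)\<close> with
  \<open>norm x \<le> t \<le> h x\<close>; rescaling \<open>x\<close> by \<open>t\<close> gives one side, rescaling \<open>t\<close> by \<open>h x\<close> the other.\<close>

lemma emeasure_radial_subgraph:
  fixes h :: "'a::euclidean_space \<Rightarrow> real"
  assumes [measurable]: "h \<in> borel_measurable borel"
    and nonneg: "\<And>x. 0 \<le> h x" and hom: "\<And>c x. 0 < c \<Longrightarrow> h (c *\<^sub>R x) = h x"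
  shows "emeasure lborel {x. norm x \<le> h x} =
    (\<integral>\<^sup>+x. ennreal (h x ^ DIM('a)) * indicator (cball 0 1) x \<partial>lborel)"
proof -
  define N where "N = DIM('a)"
  have N: "0 < N" by (simp add: N_def)
  define W where "W x t = (if x \<noteq> 0 \<and> 0 < t \<and> norm x \<le> t \<and> t \<le> h x then ennreal (real N / t) else 0)"
    for x t
  have [measurable]: "(\<lambda>(x, t). W x t) \<in> borel_measurable (borel \<Otimes>\<^sub>M borel)"
    unfolding W_def by measurable
  \<comment> \<open>\<open>U s x\<close> is \<open>W x t\<close> under the substitution
    \<open>t = h x * s\<close>, with the factor \<open>h x\<close> from the change of variable
    absorbed.\<close>
  define U where "U s x = (if x \<noteq> 0 \<and> 0 < s \<and> s \<le> 1 \<and> norm x \<le> s * h x then ennreal (real N / s) else 0)"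
    for s x
  have [measurable]: "(\<lambda>(s, x). U s x) \<in> borel_measurable (borel \<Otimes>\<^sub>M borel)"
    unfolding U_def by measurable
  define A where "A = {x. x \<noteq> 0 \<and> norm x \<le> h x}"
  have [measurable]: "A \<in> sets borel"
    unfolding A_def by measurable
  have "emeasure lborel {x. norm x \<le> h x} = emeasure lborel A"
  proof (rule emeasure_eq_AE)
    show "AE x in lborel. (x \<in> {x. norm x \<le> h x}) = (x \<in> A)"
      by (rule AE_I[of _ _ "{0}"]) (auto simp: A_def)
  qed measurable
  \<comment> \<open>The inserted integral of \<open>N * s ^ (N - 1)\<close> over
    \<open>{0<..1}\<close> equals 1.\<close>
  also have "\<dots> = (\<integral>\<^sup>+s. ennreal (real N * s ^ (N - 1)) * indicator {0<..1} s * emeasure lborel A \<partial>lborel)"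
    using nn_integral_power_Ioc[of 1 N] N by (subst nn_integral_multc) simp_all
  also have "\<dots> = (\<integral>\<^sup>+s. \<integral>\<^sup>+x. U s x \<partial>lborel \<partial>lborel)"
  proof (rule nn_integral_cong)
    fix s :: real
    show "ennreal (real N * s ^ (N - 1)) * indicator {0<..1} s * emeasure lborel A = (\<integral>\<^sup>+x. U s x \<partial>lborel)"
    proof (cases "0 < s \<and> s \<le> 1")
      case True
      then have s: "0 < s" "s \<le> 1" by auto
      \<comment> \<open>Since \<open>h\<close> is homogeneous of degree 0, rescaling
        \<open>x\<close> by \<open>s\<close> turns the region into \<open>A\<close>, whatever
        \<open>s\<close> is.\<close>
      have "(\<integral>\<^sup>+x. U s x \<partial>lborel) = ennreal (s ^ DIM('a)) * (\<integral>\<^sup>+x. U s (s *\<^sub>R x) \<partial>lborel)"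
        by (rule nn_integral_lborel_scale) (use s in measurable)
      also have "(\<lambda>x. U s (s *\<^sub>R x)) = (\<lambda>x. ennreal (real N / s) * indicator A x)"
        using s by (auto simp: fun_eq_iff U_def A_def hom indicator_def)
      also have "(\<integral>\<^sup>+x. \<dots> x \<partial>lborel) = ennreal (real N / s) * emeasure lborel A"
        by (simp add: nn_integral_cmult)
      also have "ennreal (s ^ DIM('a)) * (ennreal (real N / s) * emeasure lborel A) =
          ennreal (s ^ N * (real N / s)) * emeasure lborel A"
        using s by (subst ennreal_mult) (simp_all add: mult.assoc N_def)
      also have "s ^ N * (real N / s) = real N * s ^ (N - 1)"
        using s N by (cases N) auto
      finally show ?thesis using s by simp
    qed (auto simp: U_def)
  qed
  also have "\<dots> = (\<integral>\<^sup>+x. \<integral>\<^sup>+s. U s x \<partial>lborel \<partial>lborel)"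
    by (rule lborel_pair.Fubini') measurable
  also have "\<dots> = (\<integral>\<^sup>+x. \<integral>\<^sup>+t. W x t \<partial>lborel \<partial>lborel)"
  proof (rule nn_integral_cong)
    fix x :: 'a
    show "(\<integral>\<^sup>+s. U s x \<partial>lborel) = (\<integral>\<^sup>+t. W x t \<partial>lborel)"
    proof (cases "h x = 0")
      case True
      then have "U s x = 0" "W x s = 0" for s
        by (auto simp: U_def W_def)
      then show ?thesis by simp
    next
      case False
      then have h: "0 < h x" using nonneg[of x] by simp
      have "(\<integral>\<^sup>+t. W x t \<partial>lborel) = ennreal (h x ^ DIM(real)) * (\<integral>\<^sup>+s. W x (h x *\<^sub>R s) \<partial>lborel)"
        by (rule nn_integral_lborel_scale) (use h in measurable)
      also have "\<dots> = (\<integral>\<^sup>+s. ennreal (h x) * W x (h x * s) \<partial>lborel)"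
        by (subst nn_integral_cmult) auto
      also have "\<dots> = (\<integral>\<^sup>+s. U s x \<partial>lborel)"
      proof (rule nn_integral_cong)
        fix s
        show "ennreal (h x) * W x (h x * s) = U s x"
          using h by (auto simp: W_def U_def mult.commute zero_less_mult_iff mult_le_cancel_left1 simp flip: ennreal_mult'')
      qed
      finally show ?thesis ..
    qed
  qed
  also have "\<dots> = (\<integral>\<^sup>+t. \<integral>\<^sup>+x. W x t \<partial>lborel \<partial>lborel)"
    by (rule lborel_pair.Fubini'[symmetric]) measurable
  also have "\<dots> = (\<integral>\<^sup>+t. \<integral>\<^sup>+x. ennreal (real N * t ^ (N - 1)) * indicator {0<..h x} t *
      indicator (cball 0 1) x \<partial>lborel \<partial>lborel)"
  proof (rule nn_integral_cong)
    fix t :: real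
    show "(\<integral>\<^sup>+x. W x t \<partial>lborel) = (\<integral>\<^sup>+x. ennreal (real N * t ^ (N - 1)) * indicator {0<..h x} t *
      indicator (cball 0 1) x \<partial>lborel)"
    proof (cases "0 < t")
      case True
      \<comment> \<open>Rescaling \<open>x\<close> by \<open>t\<close> turns
        \<open>norm x \<le> t\<close> into membership in the unit ball and leaves
        \<open>t \<le> h x\<close> unchanged.\<close>
      have "(\<integral>\<^sup>+x. W x t \<partial>lborel) = ennreal (t ^ DIM('a)) * (\<integral>\<^sup>+x. W (t *\<^sub>R x) t \<partial>lborel)"
        by (rule nn_integral_lborel_scale) (use True in measurable)
      also have "\<dots> = (\<integral>\<^sup>+x. ennreal (t ^ DIM('a)) * W (t *\<^sub>R x) t \<partial>lborel)"
        by (rule nn_integral_cmult[symmetric]) measurable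
      also have "\<dots> = (\<integral>\<^sup>+x. ennreal (real N * t ^ (N - 1)) * indicator {0<..h x} t *
          indicator (cball 0 1) x \<partial>lborel)"
      proof (intro nn_integral_cong_AE AE_I[of _ _ "{0}"])
        have "t ^ N * (real N / t) = real N * t ^ (N - 1)"
          using True N by (cases N) auto
        then have *: "ennreal (t ^ DIM('a)) * ennreal (real N / t) = ennreal (real N * t ^ (N - 1))"
          using True by (simp add: N_def flip: ennreal_mult)
        show "{x \<in> space lborel. ennreal (t ^ DIM('a)) * W (t *\<^sub>R x) t \<noteq>
          ennreal (real N * t ^ (N - 1)) * indicator {0<..h x} t * indicator (cball 0 1) x} \<subseteq> {0}"
          using True by (auto simp: W_def * hom indicator_def)
      qed auto
      finally show ?thesis .
    qed (auto simp: W_def)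
  qed
  also have "\<dots> = (\<integral>\<^sup>+x. \<integral>\<^sup>+t. ennreal (real N * t ^ (N - 1)) * indicator {0<..h x} t *
      indicator (cball 0 1) x \<partial>lborel \<partial>lborel)"
  proof (rule lborel_pair.Fubini')
    have "(\<lambda>(x, t). ennreal (real N * t ^ (N - 1)) * (if 0 < t \<and> t \<le> h x \<and> norm x \<le> 1 then 1 else 0)) \<in> borel_measurable (lborel \<Otimes>\<^sub>M lborel)"
      by measurable
    then show "(\<lambda>(x, t). ennreal (real N * t ^ (N - 1)) * indicator {0<..h x} t *
      indicator (cball 0 1) x) \<in> borel_measurable (lborel \<Otimes>\<^sub>M lborel)"
      by (rule measurable_cong[THEN iffD1, rotated]) (auto simp: indicator_def)
  qed
  also have "\<dots> = (\<integral>\<^sup>+x. ennreal (h x ^ N) * indicator (cball 0 1) x \<partial>lborel)"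
    by (subst nn_integral_multc) (simp_all add: nn_integral_power_Ioc[unfolded One_nat_def] nonneg N)
  finally show ?thesis by (simp add: N_def)
qed

section \<open>Integration over the sphere through homogeneous extension\<close>

lemma scaleR_inverse_norm_in_sphere: "x \<noteq> 0 \<Longrightarrow> x /\<^sub>R norm x \<in> sphere 0 1"
  for x :: "'a::real_normed_vector"
  by simp

text \<open>The extension homogeneous of degree 0. The value 0 at the origin is compatible with sums
  and positive powers.\<close>

definition radial_extension :: "('a::euclidean_space \<Rightarrow> real) \<Rightarrow> 'a \<Rightarrow> real" where
  "radial_extension f x = (if x = 0 then 0 else f (x /\<^sub>R norm x))"

text \<open>In polar coordinates, the integral of \<open>f\<close> over the sphere divided by the
  dimension. With this normalisation the volume of a star body is the value at the
  \<open>n\<close>-th power of its radial function.\<close>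

definition radial_integral :: "('a::euclidean_space \<Rightarrow> real) \<Rightarrow> real" where
  "radial_integral f = (LINT x:cball 0 1|lborel. radial_extension f x)"

lemma continuous_on_radial_extension:
  fixes f :: "'a::euclidean_space \<Rightarrow> real"
  assumes "continuous_on (sphere 0 1) f"
  shows "continuous_on (- {0}) (radial_extension f)"
proof -
  have "continuous_on (- {0}) (\<lambda>x. f (x /\<^sub>R norm x))"
    by (intro continuous_on_compose2[OF assms] continuous_intros image_subsetI
        scaleR_inverse_norm_in_sphere) auto
  then show ?thesis
    by (rule continuous_on_eq) (simp add: radial_extension_def)
qed

lemma radial_extension_measurable:
  fixes f :: "'a::euclidean_space \<Rightarrow> real"
  assumes "continuous_on (sphere 0 1) f"
  shows "radial_extension f \<in> borel_measurable borel"
proof -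
  \<comment> \<open>The extension may be discontinuous at the origin, so it is restricted to the
    complement, outside of which it vanishes.\<close>
  have "(\<lambda>x. indicator (- {0}) x *\<^sub>R radial_extension f x) \<in> borel_measurable borel"
    using continuous_on_radial_extension[OF assms]
    by (intro borel_measurable_continuous_on_indicator) auto
  also have "(\<lambda>x. indicator (- {0}) x *\<^sub>R radial_extension f x) = radial_extension f"
    by (auto simp: radial_extension_def indicator_def)
  finally show ?thesis .
qed

lemma radial_extension_nonneg:
  "f \<in> nonneg_continuous (sphere 0 1) \<Longrightarrow> 0 \<le> radial_extension f x"
  by (auto simp: radial_extension_def nonneg_continuous_def)

lemma radial_extension_scaleR:
  assumes "0 < c"
  shows "radial_extension f (c *\<^sub>R x) = radial_extension f x"
proof -
  have "(c *\<^sub>R x) /\<^sub>R norm (c *\<^sub>R x) = (inverse (c * norm x) * c) *\<^sub>R x"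
    using assms by simp
  also have "inverse (c * norm x) * c = inverse (norm x)"
    using assms by (simp add: inverse_eq_divide)
  finally have eq: "(c *\<^sub>R x) /\<^sub>R norm (c *\<^sub>R x) = x /\<^sub>R norm x" .
  show ?thesis
    unfolding radial_extension_def eq using assms by simp
qed

lemma set_integrable_radial_extension:
  fixes f :: "'a::euclidean_space \<Rightarrow> real"
  assumes f: "continuous_on (sphere 0 1) f"
  shows "set_integrable lborel (cball 0 1) (radial_extension f)"
proof -
  have "bounded (f ` sphere 0 1)"
    by (intro compact_imp_bounded compact_continuous_image f compact_sphere)
  then obtain B where B: "\<And>u. u \<in> sphere 0 1 \<Longrightarrow> \<bar>f u\<bar> \<le> B"
    unfolding bounded_iff by (metis imageI real_norm_def)
  have "\<bar>radial_extension f x\<bar> \<le> max B 0" for x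
    using B[OF scaleR_inverse_norm_in_sphere] by (cases "x = 0") (auto simp: radial_extension_def max.coboundedI1)
  then show ?thesis
    using radial_extension_measurable[OF f] emeasure_bounded_finite[of "cball (0::'a) 1"]
    unfolding set_integrable_def
    by (intro integrableI_bounded_set_indicator[where B = "max B 0"]) auto
qed

interpretation radial_integral: positive_functional "sphere 0 1" radial_integral
proof
  fix f g :: "'a \<Rightarrow> real"
  assume f: "f \<in> nonneg_continuous (sphere 0 1)"
  show "0 \<le> radial_integral f"
    unfolding radial_integral_def set_lebesgue_integral_def
    by (intro integral_nonneg_AE) (simp add: radial_extension_nonneg[OF f])
  assume g: "g \<in> nonneg_continuous (sphere 0 1)"
  have "radial_extension (\<lambda>u. f u + g u) = (\<lambda>x. radial_extension f x + radial_extension g x)"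
    by (auto simp: radial_extension_def)
  then show "radial_integral (\<lambda>u. f u + g u) = radial_integral f + radial_integral g"
    unfolding radial_integral_def
    by (simp add: set_integral_add set_integrable_radial_extension nonneg_continuousD(1)[OF f]
        nonneg_continuousD(1)[OF g])
qed

text \<open>A positive value of \<open>f\<close> makes the extension positive on a nonempty open
  part of the ball, which cannot be a null set.\<close>

lemma radial_integral_eq_0D:
  fixes f :: "'a::euclidean_space \<Rightarrow> real"
  assumes f: "f \<in> nonneg_continuous (sphere 0 1)" and 0: "radial_integral f = 0"
    and u: "u \<in> sphere 0 1"
  shows "f u = 0"
proof (rule ccontr)
  assume "f u \<noteq> 0"
  then have pos: "0 < f u" using nonneg_continuousD(2)[OF f u] by simp
  have "AE x in lborel. indicator (cball 0 1) x *\<^sub>R radial_extension f x = 0"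
    using 0 set_integrable_radial_extension[OF nonneg_continuousD(1)[OF f]] radial_extension_nonneg[OF f]
    unfolding radial_integral_def set_lebesgue_integral_def set_integrable_def
    by (subst (asm) integral_nonneg_eq_0_iff_AE) auto
  then have ae: "AE x in lborel. x \<in> cball 0 1 \<longrightarrow> radial_extension f x = 0"
    by (rule eventually_mono) (auto simp: indicator_def)
  define U where "U = ball 0 1 \<inter> (- {0} \<inter> radial_extension f -` {0<..})"
  have "open U"
    unfolding U_def
    using continuous_on_radial_extension[OF nonneg_continuousD(1)[OF f]]
    by (intro open_Int open_ball continuous_open_preimage) auto
  \<comment> \<open>The half vector lies in the open ball, unlike \<open>u\<close>, and the
    extension takes the value \<open>f u\<close> there.\<close>
  moreover have "(1/2) *\<^sub>R u \<in> U"
    using u pos by (auto simp: U_def radial_extension_def)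
  ultimately have "\<not> negligible U"
    by (intro open_not_negligible) auto
  moreover have "negligible U"
  proof -
    have "AE x in lborel. x \<notin> U"
      using ae by (rule eventually_mono) (auto simp: U_def)
    then have "U \<in> null_sets lborel"
      using \<open>open U\<close> by (subst AE_iff_null_sets) auto
    then show ?thesis
      by (simp add: negligible_iff_null_sets null_sets_completionI)
  qed
  ultimately show False by simp
qed


section \<open>Star bodies and their radial functions\<close>

lemma star_of_cong:
  "(\<And>u. u \<in> sphere 0 1 \<Longrightarrow> f u = g u) \<Longrightarrow> star_of f = star_of g"
  unfolding star_of_def by (intro Collect_cong ex_cong1 conj_cong refl) simp

lemma star_of_nonneg_continuous:
  "f \<in> nonneg_continuous (sphere 0 1) \<Longrightarrow> star_of f \<in> star_bodies"
  by (intro star_of_in_star_bodies) (auto simp: nonneg_continuous_def)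

lemma radial_function_star_of_nonneg_continuous:
  "f \<in> nonneg_continuous (sphere 0 1) \<Longrightarrow> u \<in> sphere 0 1 \<Longrightarrow> radial_function (star_of f) u = f u"
  by (intro radial_function_star_of) (auto simp: nonneg_continuous_def)

lemma radial_function_nonneg_continuous:
  "L \<in> star_bodies \<Longrightarrow> radial_function L \<in> nonneg_continuous (sphere 0 1)"
  by (auto simp: nonneg_continuous_def radial_function_nonneg) (auto simp: star_bodies_def)

text \<open>Puts a star body into the form whose volume \<open>emeasure_radial_subgraph\<close>
  computes.\<close>

lemma star_of_eq_radial_extension:
  fixes f :: "real^'n \<Rightarrow> real"
  assumes f: "f \<in> nonneg_continuous (sphere 0 1)"
  shows "star_of f = {x. norm x \<le> radial_extension f x}"
proof (intro set_eqI iffI)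
  fix x assume "x \<in> star_of f"
  then obtain r u where x: "x = r *\<^sub>R u" "norm u = 1" "0 \<le> r" "r \<le> f u"
    unfolding star_of_def mem_Collect_eq mem_sphere_0 by blast
  then show "x \<in> {x. norm x \<le> radial_extension f x}"
    by (cases "r = 0") (auto simp: radial_extension_def)
next
  fix x assume x: "x \<in> {x. norm x \<le> radial_extension f x}"
  show "x \<in> star_of f"
  proof (cases "x = 0")
    case True
    then show ?thesis
      using star_of_nonneg_continuous[OF f] by (simp add: star_bodies_def)
  next
    case False
    then have "x = norm x *\<^sub>R (x /\<^sub>R norm x)" "norm x \<le> f (x /\<^sub>R norm x)"
      using x by (auto simp: radial_extension_def)
    then show ?thesis
      using scaleR_inverse_norm_in_sphere[OF False] unfolding star_of_def
      by (intro CollectI exI[of _ "norm x"] exI[of _ "x /\<^sub>R norm x"]) simp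
  qed
qed

lemma star_of_zero: "star_of (\<lambda>u. 0) = ({0} :: (real^'n) set)"
  by (simp add: star_of_eq_radial_extension radial_extension_def)

text \<open>Compactness turns the supremum in the radial function into a maximum, and starshapedness
  fills the segment up to it.\<close>

lemma star_of_radial_function:
  fixes L :: "(real^'n) set"
  assumes L: "L \<in> star_bodies"
  shows "star_of (radial_function L) = L"
proof (intro set_eqI iffI)
  let ?C = "\<lambda>u. {c. 0 \<le> c \<and> c *\<^sub>R u \<in> L}"
  have compact: "compact L" and "0 \<in> L" and seg: "\<And>x. x \<in> L \<Longrightarrow> closed_segment 0 x \<subseteq> L"
    using L by (auto simp: star_bodies_def)
  obtain B where B: "\<And>x. x \<in> L \<Longrightarrow> norm x \<le> B"
    using compact_imp_bounded[OF compact] by (auto simp: bounded_iff)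
  have bdd: "bdd_above (?C u)" if "norm u = 1" for u
    using B that by (intro bdd_aboveI[of _ B]) fastforce
  fix x
  {
    assume x: "x \<in> L"
    show "x \<in> star_of (radial_function L)"
    proof (cases "x = 0")
      case True
      then show ?thesis
        using star_of_nonneg_continuous[OF radial_function_nonneg_continuous[OF L]]
        by (simp add: star_bodies_def)
    next
      case False
      have "norm x \<le> radial_function L (x /\<^sub>R norm x)"
        unfolding radial_function_def using False x by (intro cSup_upper bdd) auto
      then show ?thesis
        using False x by (simp add: star_of_eq_radial_extension[OF radial_function_nonneg_continuous[OF L]]
            radial_extension_def)
    qed
  next
    assume "x \<in> star_of (radial_function L)"
    then obtain r u where x: "x = r *\<^sub>R u" "norm u = 1" "0 \<le> r" "r \<le> radial_function L u"
      unfolding star_of_def mem_Collect_eq mem_sphere_0 by blast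
    have "closed ({0..} \<inter> (\<lambda>c. c *\<^sub>R u) -` L)"
      using compact_imp_closed[OF compact]
      by (intro closed_Int closed_vimage continuous_intros) auto
    also have "{0..} \<inter> (\<lambda>c. c *\<^sub>R u) -` L = ?C u" by auto
    finally have "radial_function L u \<in> ?C u"
      unfolding radial_function_def using \<open>0 \<in> L\<close> bdd[OF x(2)]
      by (intro closed_contains_Sup) (auto intro: exI[of _ 0])
    then have "closed_segment 0 (radial_function L u *\<^sub>R u) \<subseteq> L"
      using seg by simp
    moreover have "x \<in> closed_segment 0 (radial_function L u *\<^sub>R u)"
    proof (cases "radial_function L u = 0")
      case False
      then show ?thesis
        using x by (auto simp: in_segment intro!: exI[of _ "r / radial_function L u"])
    qed (use x in simp)
    ultimately show "x \<in> L" by blast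
  }
qed

lemma star_bodies_eqI:
  fixes K L :: "(real^'n) set"
  assumes "K \<in> star_bodies" "L \<in> star_bodies"
    and "\<And>u. u \<in> sphere 0 1 \<Longrightarrow> radial_function K u = radial_function L u"
  shows "K = L"
proof -
  have "star_of (radial_function K) = star_of (radial_function L)"
    by (rule star_of_cong) (rule assms(3))
  then show ?thesis by (simp only: assms(1,2) star_of_radial_function)
qed

section \<open>Volume, dilates and rotated images of star bodies\<close>

lemma measure_star_of:
  fixes f :: "real^'n \<Rightarrow> real"
  assumes f: "f \<in> nonneg_continuous (sphere 0 1)"
  shows "measure lebesgue (star_of f) = radial_integral (\<lambda>u. f u ^ CARD('n))"
proof -
  let ?h = "radial_extension f"
  have [measurable]: "?h \<in> borel_measurable borel"
    by (intro radial_extension_measurable nonneg_continuousD(1)[OF f])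
  \<comment> \<open>At the origin both sides vanish, as the exponent is positive.\<close>
  have pow: "radial_extension (\<lambda>u. f u ^ CARD('n)) x = ?h x ^ CARD('n)" for x
    by (simp add: radial_extension_def)
  have "radial_integral (\<lambda>u. f u ^ CARD('n)) =
      enn2real (\<integral>\<^sup>+x. ennreal (indicator (cball 0 1) x *\<^sub>R ?h x ^ CARD('n)) \<partial>lborel)"
    unfolding radial_integral_def set_lebesgue_integral_def pow
  proof (rule integral_eq_nn_integral)
    show "(\<lambda>x. indicator (cball 0 1) x *\<^sub>R ?h x ^ CARD('n)) \<in> borel_measurable lborel"
      using borel_measurable_indicator[of "cball (0::real^'n) 1" lborel] by measurable
  qed (simp add: radial_extension_nonneg[OF f])
  also have "(\<integral>\<^sup>+x. ennreal (indicator (cball 0 1) x *\<^sub>R ?h x ^ CARD('n)) \<partial>lborel) =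
      (\<integral>\<^sup>+x. ennreal (?h x ^ DIM(real^'n)) * indicator (cball 0 1) x \<partial>lborel)"
    by (intro nn_integral_cong) (auto simp: indicator_def)
  also have "\<dots> = emeasure lborel {x. norm x \<le> ?h x}"
    by (intro emeasure_radial_subgraph[symmetric] radial_extension_nonneg[OF f]
        radial_extension_scaleR) simp_all
  also have "enn2real \<dots> = measure lebesgue (star_of f)"
    unfolding star_of_eq_radial_extension[OF f] measure_def by (subst emeasure_completion) auto
  finally show ?thesis ..
qed

lemma scaleR_image_star_of:
  assumes "0 < c"
  shows "(*\<^sub>R) c ` star_of f = star_of (\<lambda>u. c * f u)"
proof (intro set_eqI iffI)
  fix x assume "x \<in> (*\<^sub>R) c ` star_of f"
  then obtain r u where "x = (c * r) *\<^sub>R u" "u \<in> sphere 0 1" "0 \<le> r" "r \<le> f u"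
    by (auto simp: star_of_def)
  then show "x \<in> star_of (\<lambda>u. c * f u)"
    using assms unfolding star_of_def by (intro CollectI exI[of _ "c * r"] exI[of _ u]) auto
next
  fix x assume "x \<in> star_of (\<lambda>u. c * f u)"
  then obtain r u where x: "x = r *\<^sub>R u" "u \<in> sphere 0 1" "0 \<le> r" "r \<le> c * f u"
    by (auto simp: star_of_def)
  then have "(r / c) *\<^sub>R u \<in> star_of f"
    using assms unfolding star_of_def
    by (intro CollectI exI[of _ "r / c"] exI[of _ u]) (auto simp: pos_divide_le_eq mult.commute)
  then show "x \<in> (*\<^sub>R) c ` star_of f"
    using x assms by (intro image_eqI[of _ _ "(r / c) *\<^sub>R u"]) auto
qed

text \<open>The transpose is the inverse of \<open>A\<close>, and both preserve the sphere.\<close>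

lemma orthogonal_matrix_image_star_of:
  fixes A :: "real^'n^'n"
  assumes A: "orthogonal_matrix A"
  shows "(*v) A ` star_of f = star_of (\<lambda>u. f (transpose A *v u))"
proof -
  have norm: "norm (A *v x) = norm x" "norm (transpose A *v x) = norm x" for x
    using A orthogonal_transformation_norm[of "(*v) A"] orthogonal_transformation_norm[of "(*v) (transpose A)"]
    by (auto simp: orthogonal_transformation_matrix orthogonal_matrix_transpose)
  have inv: "A *v (transpose A *v x) = x" "transpose A *v (A *v x) = x" for x
    using A by (simp_all only: orthogonal_matrix_def matrix_vector_mul_assoc matrix_vector_mul_lid)
  show ?thesis
  proof (intro set_eqI iffI)
    fix x assume "x \<in> (*v) A ` star_of f"
    then obtain r u where "x = r *\<^sub>R (A *v u)" "norm u = 1" "0 \<le> r" "r \<le> f u"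
      by (auto simp: star_of_def matrix_vector_mult_scaleR)
    then show "x \<in> star_of (\<lambda>u. f (transpose A *v u))"
      unfolding star_of_def by (intro CollectI exI[of _ r] exI[of _ "A *v u"]) (auto simp: norm inv simp del: transpose_matrix_vector)
  next
    fix x assume "x \<in> star_of (\<lambda>u. f (transpose A *v u))"
    then obtain r u where x: "x = r *\<^sub>R u" "norm u = 1" "0 \<le> r" "r \<le> f (transpose A *v u)"
      unfolding star_of_def mem_Collect_eq mem_sphere_0 by blast
    then have "r *\<^sub>R (transpose A *v u) \<in> star_of f"
      unfolding star_of_def
      by (intro CollectI exI[of _ r] exI[of _ "transpose A *v u"]) (auto simp: norm simp del: transpose_matrix_vector)
    then show "x \<in> (*v) A ` star_of f"
      using x by (intro image_eqI[of _ _ "r *\<^sub>R (transpose A *v u)"])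
        (auto simp: matrix_vector_mult_scaleR inv simp del: transpose_matrix_vector)
  qed
qed


section \<open>Radial Blaschke Minkowski homomorphisms\<close>

text \<open>The bound on the dimension makes \<open>CARD('n) - 1\<close> positive, so that roots and
  powers of this order are inverse on nonnegative numbers, and it provides rotations between any two
  unit vectors.\<close>

locale radial_hom =
  fixes \<Psi> :: "(real^'n) set \<Rightarrow> (real^'n) set"
  assumes card: "2 \<le> CARD('n)" and hom: "radial_blaschke_minkowski_hom \<Psi>"
begin

text \<open>The argument stands for the \<open>(n-1)\<close>-th power of a radial function, whereas
  the value is a radial function itself.\<close>

definition \<Phi> :: "(real^'n \<Rightarrow> real) \<Rightarrow> real^'n \<Rightarrow> real" where
  "\<Phi> f = radial_function (\<Psi> (star_of (\<lambda>u. root (CARD('n) - 1) (f u))))"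

lemma \<Psi>_star_bodies: "L \<in> star_bodies \<Longrightarrow> \<Psi> L \<in> star_bodies"
  using hom by (auto simp: radial_blaschke_minkowski_hom_def)

lemma \<Phi>_nonneg_continuous:
  "f \<in> nonneg_continuous (sphere 0 1) \<Longrightarrow> \<Phi> f \<in> nonneg_continuous (sphere 0 1)"
  unfolding \<Phi>_def
  by (intro radial_function_nonneg_continuous \<Psi>_star_bodies star_of_nonneg_continuous
      nonneg_continuous_closed)

lemma \<Phi>_cong: "(\<And>u. u \<in> sphere 0 1 \<Longrightarrow> f u = g u) \<Longrightarrow> \<Phi> f = \<Phi> g"
  unfolding \<Phi>_def by (rule arg_cong[where f = "\<lambda>L. radial_function (\<Psi> L)"], rule star_of_cong) simp

lemma radial_function_\<Psi>:
  assumes "L \<in> star_bodies"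
  shows "radial_function (\<Psi> L) = \<Phi> (\<lambda>u. radial_function L u ^ (CARD('n) - 1))"
proof -
  have "star_of (\<lambda>u. root (CARD('n) - 1) (radial_function L u ^ (CARD('n) - 1))) = star_of (radial_function L)"
    using card radial_function_nonneg[OF assms]
    by (intro star_of_cong real_root_power_cancel) auto
  then show ?thesis
    by (simp only: \<Phi>_def star_of_radial_function[OF assms])
qed

lemma \<Phi>_add:
  assumes f: "f \<in> nonneg_continuous (sphere 0 1)" and g: "g \<in> nonneg_continuous (sphere 0 1)"
    and u: "u \<in> sphere 0 1"
  shows "\<Phi> (\<lambda>u. f u + g u) u = \<Phi> f u + \<Phi> g u"
proof -
  let ?p = "CARD('n) - 1"
  let ?K = "star_of (\<lambda>u. root ?p (f u))" and ?L = "star_of (\<lambda>u. root ?p (g u))"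
  have KL: "?K \<in> star_bodies" "?L \<in> star_bodies"
    by (intro star_of_nonneg_continuous nonneg_continuous_closed f g)+
  have "root ?p (radial_function ?K v ^ ?p + radial_function ?L v ^ ?p) = root ?p (f v + g v)"
    if "v \<in> sphere 0 1" for v
    using card nonneg_continuousD(2)[OF f that] nonneg_continuousD(2)[OF g that]
    by (simp only: radial_function_star_of_nonneg_continuous[OF nonneg_continuous_closed(3)[OF f] that]
        radial_function_star_of_nonneg_continuous[OF nonneg_continuous_closed(3)[OF g] that]) simp
  then have "radial_blaschke_sum ?K ?L = star_of (\<lambda>u. root ?p (f u + g u))"
    unfolding radial_blaschke_sum_def by (rule star_of_cong)
  moreover have "\<Psi> (radial_blaschke_sum ?K ?L) = radial_minkowski_sum (\<Psi> ?K) (\<Psi> ?L)"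
    using hom KL by (simp add: radial_blaschke_minkowski_hom_def)
  ultimately show ?thesis
    using radial_minkowski_sum(2)[OF \<Psi>_star_bodies \<Psi>_star_bodies u, OF KL] by (simp add: \<Phi>_def)
qed

lemma positive_functional_\<Phi>:
  assumes "u \<in> sphere 0 1"
  shows "positive_functional (sphere 0 1) (\<lambda>f. \<Phi> f u)"
  using assms by unfold_locales (auto simp: \<Phi>_add simp del: mem_sphere_0
      intro: nonneg_continuousD(2)[OF \<Phi>_nonneg_continuous])

section \<open>Triviality of the kernel of \<Phi>\<close>

text \<open>Translates membership in the kernel into a statement on bodies, to which rotation
  equivariance applies.\<close>

lemma \<Phi>_eq_0_iff:
  assumes f: "f \<in> nonneg_continuous (sphere 0 1)"
  shows "(\<forall>u\<in>sphere 0 1. \<Phi> f u = 0) \<longleftrightarrow> \<Psi> (star_of (\<lambda>u. root (CARD('n) - 1) (f u))) = {0}"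
    (is "?lhs \<longleftrightarrow> ?L = _")
proof
  have L: "?L \<in> star_bodies"
    by (intro \<Psi>_star_bodies star_of_nonneg_continuous nonneg_continuous_closed f)
  have zero: "{0} = (star_of (\<lambda>u. 0) :: (real^'n) set)" by (simp add: star_of_zero)
  show "?L = {0}" if ?lhs
    unfolding zero using that
    by (intro star_bodies_eqI L star_of_nonneg_continuous)
      (simp_all add: \<Phi>_def radial_function_star_of_nonneg_continuous)
  show ?lhs if "?L = {0}"
    unfolding \<Phi>_def that zero by (simp add: radial_function_star_of_nonneg_continuous)
qed

text \<open>Rotations fix the body \<open>{0}\<close>, so the kernel of \<Phi> is rotation
  invariant.\<close>

lemma \<Phi>_rotation_eq_0:
  fixes A :: "real^'n^'n"
  assumes f: "f \<in> nonneg_continuous (sphere 0 1)" and 0: "\<And>u. u \<in> sphere 0 1 \<Longrightarrow> \<Phi> f u = 0"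
    and A: "rotation_matrix A"
  shows "(\<lambda>u. f (transpose A *v u)) \<in> nonneg_continuous (sphere 0 1)"
    and "u \<in> sphere 0 1 \<Longrightarrow> \<Phi> (\<lambda>u. f (transpose A *v u)) u = 0"
proof -
  have orth: "orthogonal_matrix A" using A by (simp add: rotation_matrix_def)
  have "norm (transpose A *v x) = norm x" for x
    using orth orthogonal_transformation_norm[of "(*v) (transpose A)"]
    by (auto simp: orthogonal_transformation_matrix orthogonal_matrix_transpose)
  then have maps: "(*v) (transpose A) ` sphere 0 1 \<subseteq> sphere 0 1" by auto
  show cone: "(\<lambda>u. f (transpose A *v u)) \<in> nonneg_continuous (sphere 0 1)"
  proof
    show "continuous_on (sphere 0 1) (\<lambda>u. f (transpose A *v u))"
      by (rule continuous_on_compose2[OF nonneg_continuousD(1)[OF f] matrix_vector_mult_linear_continuous_on maps])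
    show "0 \<le> f (transpose A *v u)" if "u \<in> sphere 0 1" for u
      using maps that by (intro nonneg_continuousD(2)[OF f]) blast
  qed
  let ?L = "star_of (\<lambda>u. root (CARD('n) - 1) (f u))"
  have "\<Psi> ((*v) A ` ?L) = (*v) A ` \<Psi> ?L"
    using hom A star_of_nonneg_continuous[OF nonneg_continuous_closed(3)[OF f]]
    by (simp add: radial_blaschke_minkowski_hom_def)
  also have "\<Psi> ?L = {0}"
    using \<Phi>_eq_0_iff[OF f] 0 by blast
  finally have "\<Psi> (star_of (\<lambda>u. root (CARD('n) - 1) (f (transpose A *v u)))) = {0}"
    unfolding orthogonal_matrix_image_star_of[OF orth] by simp
  then show "u \<in> sphere 0 1 \<Longrightarrow> \<Phi> (\<lambda>u. f (transpose A *v u)) u = 0"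
    using \<Phi>_eq_0_iff[OF cone] by blast
qed

text \<open>If \<open>\<Phi> f = 0\<close> but \<open>f\<close> does not vanish, then finitely many rotated copies of \<open>f\<close> have a
  sum bounded below by a positive constant, which forces \<open>\<Phi>\<close> to vanish on constants, hence everywhere.\<close>

lemma \<Phi>_eq_0D:
  assumes nontrivial: "\<not> trivial_hom \<Psi>"
    and f: "f \<in> nonneg_continuous (sphere 0 1)" and 0: "\<And>u. u \<in> sphere 0 1 \<Longrightarrow> \<Phi> f u = 0"
    and v: "v \<in> sphere 0 1"
  shows "f v = 0"
proof (rule ccontr)
  assume "f v \<noteq> 0"
  \<comment> \<open>The kernel of \<Phi> in the cone; rotations and finite sums stay inside
    it.\<close>
  define Z where "Z = {g \<in> nonneg_continuous (sphere 0 1). \<forall>u\<in>sphere 0 1. \<Phi> g u = 0}"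
  have "\<exists>g. g \<in> Z \<and> (\<exists>e. 0 < e \<and> (\<forall>w\<in>sphere 0 1 \<inter> ball x e. 0 < g w))"
    if x: "x \<in> sphere 0 1" for x
  proof -
    \<comment> \<open>Rotations act transitively on the sphere, so some rotated copy of
      \<open>f\<close> is positive at the given point \<open>x\<close>.\<close>
    obtain a where a: "orthogonal_transformation a" "det (matrix a) = 1" "a v = x"
      using rotation_exists[of v x] v x card by auto
    define A where "A = matrix a"
    have A: "rotation_matrix A" and "A *v v = x"
      using a by (auto simp: A_def rotation_matrix_def orthogonal_transformation_matrix
          matrix_works orthogonal_transformation_linear)
    have "transpose A *v (A *v v) = v"
      using A by (simp only: rotation_matrix_def orthogonal_matrix_def matrix_vector_mul_assoc
          matrix_vector_mul_lid)
    then have inv: "transpose A *v x = v" by (simp only: \<open>A *v v = x\<close>)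
    let ?g = "\<lambda>u. f (transpose A *v u)"
    have g: "?g \<in> Z"
      unfolding Z_def using \<Phi>_rotation_eq_0[OF f 0 A] by blast
    have pos: "0 < ?g x"
      using nonneg_continuousD(2)[OF f v] \<open>f v \<noteq> 0\<close> unfolding inv by simp
    have "continuous_on (sphere 0 1) ?g" using g by (auto simp: Z_def nonneg_continuous_def)
    \<comment> \<open>Continuity with tolerance \<open>?g x\<close> keeps \<open>?g\<close> positive
      near \<open>x\<close>.\<close>
    then obtain e where "0 < e" and e: "\<And>w. w \<in> sphere 0 1 \<Longrightarrow> dist w x < e \<Longrightarrow> dist (?g w) (?g x) < ?g x"
      using x pos unfolding continuous_on_iff by meson
    have "0 < ?g w" if "w \<in> sphere 0 1 \<inter> ball x e" for w
      using e[of w] that by (auto simp: dist_real_def dist_commute simp del: transpose_matrix_vector)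
    then show ?thesis using g \<open>0 < e\<close> by blast
  qed
  then have "\<forall>x\<in>sphere 0 1. \<exists>g. g \<in> Z \<and> (\<exists>e. 0 < e \<and> (\<forall>w\<in>sphere 0 1 \<inter> ball x e. 0 < g w))"
    by (intro ballI)
  from bchoice[OF this] obtain G where G: "\<And>x. x \<in> sphere 0 1 \<Longrightarrow> G x \<in> Z"
    and "\<forall>x\<in>sphere 0 1. \<exists>e. 0 < e \<and> (\<forall>w\<in>sphere 0 1 \<inter> ball x e. 0 < G x w)"
    by blast
  from bchoice[OF this(2)] obtain E where E: "\<And>x. x \<in> sphere 0 1 \<Longrightarrow> 0 < E x"
    and pos: "\<And>x w. x \<in> sphere 0 1 \<Longrightarrow> w \<in> sphere 0 1 \<inter> ball x (E x) \<Longrightarrow> 0 < G x w"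
    by blast
  obtain I where I: "I \<subseteq> sphere 0 1" "finite I" "sphere 0 1 \<subseteq> (\<Union>x\<in>I. ball x (E x))"
    by (rule compactE_image[OF compact_sphere[of "0::real^'n" 1], of "sphere 0 1" "\<lambda>x. ball x (E x)"])
      (use E in auto)
  define S where "S = (\<lambda>w. \<Sum>x\<in>I. G x w)"
  have "(\<lambda>w. \<Sum>x\<in>J. G x w) \<in> Z" if "J \<subseteq> I" for J
    using finite_subset[OF that I(2)] that
  proof (induction J)
    case empty
    have "\<Phi> (\<lambda>u. 0) u = 0" if "u \<in> sphere 0 1" for u
      using \<Phi>_add[of "\<lambda>u. 0" "\<lambda>u. 0" u] that by simp
    then show ?case by (simp add: Z_def)
  next
    case (insert x J)
    then have "G x \<in> Z" "(\<lambda>w. \<Sum>x\<in>J. G x w) \<in> Z" using G I by auto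
    then have "(\<lambda>w. G x w + (\<Sum>x\<in>J. G x w)) \<in> Z"
      by (auto simp: Z_def \<Phi>_add)
    then show ?case using insert by simp
  qed
  then have S: "S \<in> Z" by (simp add: S_def)
  have "0 < S w" if w: "w \<in> sphere 0 1" for w
  proof -
    obtain x where x: "x \<in> I" "w \<in> ball x (E x)" using I(3) w by blast
    have "0 \<le> G y w" if "y \<in> I" for y
    proof (rule nonneg_continuousD(2)[OF _ w])
      show "G y \<in> nonneg_continuous (sphere 0 1)"
        using G[of y] I(1) that by (auto simp: Z_def)
    qed
    then have "G x w \<le> S w"
      unfolding S_def using I(2) x(1) by (intro member_le_sum) auto
    moreover have "0 < G x w" using pos[of x w] x I w by blast
    ultimately show ?thesis by simp
  qed
  \<comment> \<open>The minimum of the positive function \<open>S\<close> supplies the lower bound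
    \<open>d\<close>.\<close>
  moreover have "\<exists>w\<in>sphere 0 1. \<forall>u\<in>sphere 0 1. S w \<le> S u"
    using S by (intro continuous_attains_inf compact_sphere) (auto simp: Z_def nonneg_continuous_def)
  ultimately obtain d where d: "0 < d" "\<And>u. u \<in> sphere 0 1 \<Longrightarrow> d \<le> S u" by blast
  have "\<Psi> L = {0}" if L: "L \<in> star_bodies" for L
  proof -
    let ?h = "\<lambda>u. radial_function L u ^ (CARD('n) - 1)"
    have h: "?h \<in> nonneg_continuous (sphere 0 1)"
      using L by (intro nonneg_continuous_closed radial_function_nonneg_continuous)
    have "\<exists>z\<in>sphere 0 1. \<forall>u\<in>sphere 0 1. ?h u \<le> ?h z"
      using nonneg_continuousD(1)[OF h] v by (intro continuous_attains_sup compact_sphere) auto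
    then obtain z where z: "z \<in> sphere 0 1" "\<And>u. u \<in> sphere 0 1 \<Longrightarrow> ?h u \<le> ?h z"
      by blast
    have nz: "0 \<le> ?h z" using nonneg_continuousD(2)[OF h z(1)] .
    have Sc: "S \<in> nonneg_continuous (sphere 0 1)" using S by (simp add: Z_def)
    have "\<Phi> ?h u = 0" if u: "u \<in> sphere 0 1" for u
    proof -
      interpret positive_functional "sphere 0 1" "\<lambda>f. \<Phi> f u"
        using u by (rule positive_functional_\<Phi>)
      \<comment> \<open>\<open>?h\<close> is at most its maximum \<open>?h z\<close>, hence at most
        \<open>?h z / d\<close> times \<open>S\<close>, and \<Phi> annihilates
        \<open>S\<close>.\<close>
      have "\<Phi> ?h u \<le> \<Phi> (\<lambda>w. ?h z / d * S w) u"
      proof (rule mono[OF h])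
        show "?h w \<le> ?h z / d * S w" if "w \<in> sphere 0 1" for w
        proof -
          have "?h w \<le> ?h z" using z that by blast
          also have "\<dots> = ?h z / d * d" using d by simp
          also have "\<dots> \<le> ?h z / d * S w"
            using d(2)[OF that] d(1) nz by (intro mult_left_mono) simp_all
          finally show ?thesis .
        qed
      qed (intro nonneg_continuous_closed(2) Sc divide_nonneg_pos nz d(1))
      also have "\<dots> = ?h z / d * \<Phi> S u"
        by (intro scale Sc divide_nonneg_pos nz d(1))
      also have "\<dots> = 0" using S u by (simp add: Z_def)
      finally show ?thesis using nonneg[OF h] by simp
    qed
    then have "radial_function (\<Psi> L) u = radial_function (star_of (\<lambda>u. 0)) u" if "u \<in> sphere 0 1" for u
      using that by (simp add: radial_function_\<Psi>[OF L] radial_function_star_of_nonneg_continuous)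
    then have "\<Psi> L = star_of (\<lambda>u. 0)"
      by (rule star_bodies_eqI[OF \<Psi>_star_bodies[OF L] star_of_nonneg_continuous, rotated]) simp_all
    then show ?thesis by (simp add: star_of_zero)
  qed
  then show False using nontrivial by (simp add: trivial_hom_def)
qed

declare One_nat_def [simp del]

section \<open>Volumes of the image bodies\<close>

lemma \<Phi>_scale:
  assumes "f \<in> nonneg_continuous (sphere 0 1)" "0 \<le> c" "u \<in> sphere 0 1"
  shows "\<Phi> (\<lambda>u. c * f u) u = c * \<Phi> f u"
  using positive_functional.scale[OF positive_functional_\<Phi>[OF assms(3)] assms(1,2)] .

lemma measure_\<Psi>:
  assumes "L \<in> star_bodies"
  shows "measure lebesgue (\<Psi> L) =
    radial_integral (\<lambda>u. radial_function (\<Psi> L) u ^ CARD('n))"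
  using measure_star_of[OF radial_function_nonneg_continuous[OF \<Psi>_star_bodies[OF assms]]]
  by (simp only: star_of_radial_function[OF \<Psi>_star_bodies[OF assms]])

text \<open>Not the volume of \<open>L\<close>, but that of its image under \<Psi>, raised to the
  exponent of the theorem.\<close>

definition V :: "(real^'n) set \<Rightarrow> real" where
  "V L = measure lebesgue (\<Psi> L) powr (1 / (real CARD('n) * (real CARD('n) - 1)))"

lemma exponent: "real CARD('n) * (real CARD('n) - 1) = real ((CARD('n) - 1) * CARD('n))"
  using card by (simp add: of_nat_diff)

lemma V_nonneg: "0 \<le> V L"
  by (simp add: V_def)

lemma V_power: "V L ^ ((CARD('n) - 1) * CARD('n)) = measure lebesgue (\<Psi> L)"
proof (cases "measure lebesgue (\<Psi> L) = 0")
  case True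
  then show ?thesis using card by (simp add: V_def)
next
  case False
  then have "0 < measure lebesgue (\<Psi> L)" by (simp add: zero_less_measure_iff)
  then show ?thesis
    using card unfolding V_def exponent
    by (subst powr_realpow[symmetric]) (simp_all add: powr_powr del: of_nat_mult)
qed

lemma V_eqI:
  assumes "0 \<le> a" "measure lebesgue (\<Psi> L) = a ^ ((CARD('n) - 1) * CARD('n))"
  shows "V L = a"
proof (rule power_eq_imp_eq_base)
  show "V L ^ ((CARD('n) - 1) * CARD('n)) = a ^ ((CARD('n) - 1) * CARD('n))"
    by (simp only: V_power assms(2))
qed (use assms(1) card V_nonneg in auto)

text \<open>Chosen so that \<open>V L\<close> is the norm of \<open>\<sigma> L\<close> of order
  \<open>n * (n - 1)\<close> with respect to \<open>radial_integral\<close>.\<close>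

definition \<sigma> :: "(real^'n) set \<Rightarrow> real^'n \<Rightarrow> real" where
  "\<sigma> L u = root (CARD('n) - 1) (radial_function (\<Psi> L) u)"

lemma \<sigma>_nonneg_continuous:
  "L \<in> star_bodies \<Longrightarrow> \<sigma> L \<in> nonneg_continuous (sphere 0 1)"
  unfolding \<sigma>_def[abs_def]
  by (intro nonneg_continuous_closed radial_function_nonneg_continuous \<Psi>_star_bodies)

lemma \<sigma>_power:
  assumes "L \<in> star_bodies" "u \<in> sphere 0 1"
  shows "\<sigma> L u ^ (CARD('n) - 1) = radial_function (\<Psi> L) u"
  unfolding \<sigma>_def using card radial_function_nonneg[OF \<Psi>_star_bodies[OF assms(1)] assms(2)]
  by (intro real_root_pow_pos2) auto

lemma radial_integral_\<sigma>:
  assumes L: "L \<in> star_bodies"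
  shows "radial_integral (\<lambda>u. \<sigma> L u ^ ((CARD('n) - 1) * CARD('n))) =
    V L ^ ((CARD('n) - 1) * CARD('n))"
  unfolding V_power measure_\<Psi>[OF L]
  by (rule radial_integral.cong)
    (use L in \<open>auto simp: power_mult \<sigma>_power simp del: mem_sphere_0
      intro!: nonneg_continuous_closed(1) \<sigma>_nonneg_continuous radial_function_nonneg_continuous \<Psi>_star_bodies\<close>)

lemma \<sigma>_sum_power:
  assumes K: "K \<in> star_bodies" and L: "L \<in> star_bodies" and u: "u \<in> sphere 0 1"
  shows "\<Phi> (\<lambda>u. (radial_function K u + radial_function L u) ^ (CARD('n) - 1)) u =
    \<sigma> (radial_minkowski_sum K L) u ^ (CARD('n) - 1)"
proof -
  have "radial_function (\<Psi> (radial_minkowski_sum K L)) =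
      \<Phi> (\<lambda>u. (radial_function K u + radial_function L u) ^ (CARD('n) - 1))"
    unfolding radial_function_\<Psi>[OF radial_minkowski_sum(1)[OF K L]]
    by (rule \<Phi>_cong) (simp only: radial_minkowski_sum(2)[OF K L])
  then show ?thesis
    using \<sigma>_power[OF radial_minkowski_sum(1)[OF K L] u] by simp
qed

lemma \<Phi>_radial_function_power:
  assumes "L \<in> star_bodies" "u \<in> sphere 0 1"
  shows "\<Phi> (\<lambda>u. radial_function L u ^ (CARD('n) - 1)) u = \<sigma> L u ^ (CARD('n) - 1)"
  using assms by (simp only: \<sigma>_power radial_function_\<Psi>)

section \<open>Minkowski's inequality in each direction and over the sphere\<close>

text \<open>Minkowski's inequality of exponent \<open>n - 1\<close> for the functional
  \<open>f \<mapsto> \<Phi> f u\<close>.\<close>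

lemma \<sigma>_sum_le:
  assumes K: "K \<in> star_bodies" and L: "L \<in> star_bodies" and u: "u \<in> sphere 0 1"
  shows "\<sigma> (radial_minkowski_sum K L) u \<le> \<sigma> K u + \<sigma> L u"
proof -
  interpret positive_functional "sphere 0 1" "\<lambda>f. \<Phi> f u"
    using u by (rule positive_functional_\<Phi>)
  have nn: "0 \<le> \<sigma> K u" "0 \<le> \<sigma> L u"
    using nonneg_continuousD(2)[OF \<sigma>_nonneg_continuous u] K L by auto
  have "\<sigma> (radial_minkowski_sum K L) u ^ (CARD('n) - 1) \<le> (\<sigma> K u + \<sigma> L u) ^ (CARD('n) - 1)"
    using minkowski[OF radial_function_nonneg_continuous[OF K] radial_function_nonneg_continuous[OF L] nn,
        of "CARD('n) - 1"] card K L u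
    by (simp add: \<sigma>_sum_power \<Phi>_radial_function_power del: mem_sphere_0)
  then show ?thesis
    using nn card by (subst (asm) power_mono_iff) 
      (auto intro: nonneg_continuousD(2)[OF \<sigma>_nonneg_continuous[OF radial_minkowski_sum(1)[OF K L]] u])
qed

text \<open>The first link integrates the inequality in each direction, the second is Minkowski's
  inequality on the sphere. They are kept apart because the equality case examines each.\<close>

lemma radial_integral_\<sigma>_sum_le:
  assumes K: "K \<in> star_bodies" and L: "L \<in> star_bodies"
  defines "q \<equiv> (CARD('n) - 1) * CARD('n)"
  shows "radial_integral (\<lambda>u. \<sigma> (radial_minkowski_sum K L) u ^ q) \<le>
      radial_integral (\<lambda>u. (\<sigma> K u + \<sigma> L u) ^ q)"
    and "radial_integral (\<lambda>u. (\<sigma> K u + \<sigma> L u) ^ q) \<le> (V K + V L) ^ q"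
proof -
  have KL: "radial_minkowski_sum K L \<in> star_bodies" using K L by (rule radial_minkowski_sum(1))
  have q: "0 < q" using card by (simp add: q_def)
  show "radial_integral (\<lambda>u. (\<sigma> K u + \<sigma> L u) ^ q) \<le> (V K + V L) ^ q"
    by (rule radial_integral.minkowski)
      (auto simp: radial_integral_\<sigma>[OF K, folded q_def] radial_integral_\<sigma>[OF L, folded q_def] q V_nonneg
        intro: \<sigma>_nonneg_continuous K L)
  show "radial_integral (\<lambda>u. \<sigma> (radial_minkowski_sum K L) u ^ q) \<le>
      radial_integral (\<lambda>u. (\<sigma> K u + \<sigma> L u) ^ q)"
    using \<sigma>_nonneg_continuous[OF K] \<sigma>_nonneg_continuous[OF L] \<sigma>_nonneg_continuous[OF KL] K L
    by (intro radial_integral.mono nonneg_continuous_closed power_mono \<sigma>_sum_le)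
      (auto intro: nonneg_continuousD(2))
qed

lemma V_sum_le:
  assumes K: "K \<in> star_bodies" and L: "L \<in> star_bodies"
  shows "V (radial_minkowski_sum K L) \<le> V K + V L"
proof -
  let ?q = "(CARD('n) - 1) * CARD('n)"
  have "V (radial_minkowski_sum K L) ^ ?q \<le> (V K + V L) ^ ?q"
    using radial_integral_\<sigma>_sum_le[OF K L]
    by (simp add: radial_integral_\<sigma>[OF radial_minkowski_sum(1)[OF K L]])
  then show ?thesis
    using card V_nonneg by (subst (asm) power_mono_iff) auto
qed

section \<open>Dilates and the case of equality\<close>

lemma V_dilate:
  assumes K: "K \<in> star_bodies" and L: "L \<in> star_bodies" and c: "0 \<le> c"
    and eq: "\<And>u. u \<in> sphere 0 1 \<Longrightarrow> radial_function K u = c * radial_function L u"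
  shows "V K = c * V L"
proof (rule V_eqI)
  let ?p = "CARD('n) - 1"
  have \<Psi>: "radial_function (\<Psi> K) u = c ^ ?p * radial_function (\<Psi> L) u" if "u \<in> sphere 0 1" for u
  proof -
    have "radial_function (\<Psi> K) = \<Phi> (\<lambda>u. c ^ ?p * radial_function L u ^ ?p)"
      unfolding radial_function_\<Psi>[OF K] by (rule \<Phi>_cong) (simp only: eq power_mult_distrib)
    then show ?thesis
      using that c L by (simp add: \<Phi>_scale radial_function_\<Psi>[OF L] radial_function_nonneg_continuous
          del: mem_sphere_0)
  qed
  have cone: "radial_function (\<Psi> K) \<in> nonneg_continuous (sphere 0 1)"
      "radial_function (\<Psi> L) \<in> nonneg_continuous (sphere 0 1)"
    using K L by (simp_all add: radial_function_nonneg_continuous \<Psi>_star_bodies)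
  have "measure lebesgue (\<Psi> K) =
      radial_integral (\<lambda>u. c ^ (?p * CARD('n)) * radial_function (\<Psi> L) u ^ CARD('n))"
    unfolding measure_\<Psi>[OF K] using cone c
    by (intro radial_integral.cong) (auto simp: \<Psi> power_mult_distrib power_mult simp del: mem_sphere_0)
  also have "\<dots> = c ^ (?p * CARD('n)) * measure lebesgue (\<Psi> L)"
    unfolding measure_\<Psi>[OF L] using cone c by (intro radial_integral.scale) auto
  finally show "measure lebesgue (\<Psi> K) = (c * V L) ^ (?p * CARD('n))"
    by (simp add: V_power power_mult_distrib)
qed (use c V_nonneg in simp)

text \<open>Zero volume makes \<open>\<sigma> L\<close> vanish on the sphere, so the power of the
  radial function of \<open>L\<close> lies in the kernel of \<Phi>, which is trivial.\<close>

lemma V_eq_0D: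
  assumes nontrivial: "\<not> trivial_hom \<Psi>" and L: "L \<in> star_bodies" and 0: "V L = 0"
  shows "L = {0}"
proof -
  let ?q = "(CARD('n) - 1) * CARD('n)"
  have q: "0 < ?q" using card by simp
  have "radial_integral (\<lambda>u. \<sigma> L u ^ ?q) = 0"
    using q by (simp only: radial_integral_\<sigma>[OF L] 0 zero_power)
  then have "\<sigma> L u ^ ?q = 0" if "u \<in> sphere 0 1" for u
    using radial_integral_eq_0D[OF nonneg_continuous_closed(1)[OF \<sigma>_nonneg_continuous[OF L]] _ that] by blast
  then have "\<Phi> (\<lambda>u. radial_function L u ^ (CARD('n) - 1)) u = 0" if "u \<in> sphere 0 1" for u
    using that card by (simp add: \<Phi>_radial_function_power[OF L that])
  then have "radial_function L u ^ (CARD('n) - 1) = 0" if "u \<in> sphere 0 1" for u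
    using \<Phi>_eq_0D[OF nontrivial nonneg_continuous_closed(1)[OF radial_function_nonneg_continuous[OF L]] _ that]
    by blast
  then have "radial_function L u = 0" if "u \<in> sphere 0 1" for u
    using that by simp
  then have "star_of (radial_function L) = star_of (\<lambda>u. 0)"
    by (rule star_of_cong)
  then show ?thesis
    by (simp only: star_of_radial_function[OF L] star_of_zero)
qed

text \<open>Equality passes to both links of the chain. On the sphere it makes
  \<open>\<sigma> K\<close> and \<open>\<sigma> L\<close> proportional; in each direction it then
  puts a convexity gap of the radial functions into the kernel of \<Phi>.\<close>

lemma V_sum_eqD:
  assumes card3: "3 \<le> CARD('n)" and nontrivial: "\<not> trivial_hom \<Psi>"
    and K: "K \<in> star_bodies" and L: "L \<in> star_bodies"
    and eq: "V (radial_minkowski_sum K L) = V K + V L"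
    and pos: "0 < V K" "0 < V L"
  shows "dilates K L"
proof -
  let ?p = "CARD('n) - 1" and ?KL = "radial_minkowski_sum K L"
  let ?f = "radial_function K" and ?g = "radial_function L"
  define q where "q = ?p * CARD('n)"
  \<comment> \<open>Dimension at least 3 makes the exponent \<open>n - 1\<close> at least 2, so that
    the power is strictly convex and a vanishing gap forces proportionality.\<close>
  have p: "2 \<le> ?p" "0 < ?p" using card3 by auto
  then have q: "2 \<le> q" "0 < q"
    using card3 mult_le_mono[of 2 ?p 3 "CARD('n)"] by (auto simp: q_def)
  have KL: "?KL \<in> star_bodies" using K L by (rule radial_minkowski_sum(1))
  note cont = \<sigma>_nonneg_continuous[OF K] \<sigma>_nonneg_continuous[OF L] \<sigma>_nonneg_continuous[OF KL]
  note int = radial_integral_\<sigma>[OF K, folded q_def] radial_integral_\<sigma>[OF L, folded q_def]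
    radial_integral_\<sigma>[OF KL, folded q_def, unfolded eq]
  \<comment> \<open>The outer terms of the chain coincide, so the middle integral equals
    them.\<close>
  have sum: "radial_integral (\<lambda>u. (\<sigma> K u + \<sigma> L u) ^ q) = (V K + V L) ^ q"
    using radial_integral_\<sigma>_sum_le[OF K L, folded q_def] int by simp
  define c where "c u = \<sigma> L u / V L" for u
  have c: "\<sigma> K u = V K * c u" "\<sigma> L u = V L * c u" "\<sigma> ?KL u = (V K + V L) * c u"
    if u: "u \<in> sphere 0 1" for u
  proof -
    have nn: "0 \<le> \<sigma> K u" "0 \<le> \<sigma> L u" "0 \<le> \<sigma> ?KL u"
      using cont by (auto intro: nonneg_continuousD(2)[OF _ u])
    have "radial_integral (\<lambda>u. convexity_gap (V K) (V L) q (\<sigma> K u) (\<sigma> L u)) = 0"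
      by (rule radial_integral.minkowski_equality[where c = 1])
        (use cont pos q int sum in simp_all)
    then have "convexity_gap (V K) (V L) q (\<sigma> K u) (\<sigma> L u) = 0"
      by (rule radial_integral_eq_0D[OF convexity_gap_nonneg_continuous[OF cont(1,2) pos q(2)] _ u])
    then have 1: "\<sigma> K u / V K = \<sigma> L u / V L"
      using convexity_gap(2)[OF pos nn(1,2) q(1)] by simp
    then show KLc: "\<sigma> K u = V K * c u" "\<sigma> L u = V L * c u"
      using pos by (auto simp: c_def field_simps)
    \<comment> \<open>The defect in the inequality for each direction is nonnegative with integral
      zero, so it vanishes on the sphere.\<close>
    let ?d = "\<lambda>u. (\<sigma> K u + \<sigma> L u) ^ q - \<sigma> ?KL u ^ q"
    have d: "?d \<in> nonneg_continuous (sphere 0 1)"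
    proof
      show "continuous_on (sphere 0 1) ?d"
        by (intro continuous_intros nonneg_continuousD(1) cont)
      show "0 \<le> ?d v" if "v \<in> sphere 0 1" for v
        using \<sigma>_sum_le[OF K L that] nonneg_continuousD(2)[OF cont(3) that] by (simp add: power_mono)
    qed
    have "radial_integral (\<lambda>u. ?d u + \<sigma> ?KL u ^ q) = radial_integral ?d + radial_integral (\<lambda>u. \<sigma> ?KL u ^ q)"
      by (rule radial_integral.add[OF d nonneg_continuous_closed(1)[OF cont(3)]])
    then have "radial_integral ?d = 0" using sum int by simp
    then have "?d u = 0" using radial_integral_eq_0D[OF d _ u] by blast
    then have "(\<sigma> K u + \<sigma> L u) ^ q = \<sigma> ?KL u ^ q" by simp
    then have "\<sigma> K u + \<sigma> L u = \<sigma> ?KL u"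
      by (rule power_eq_imp_eq_base) (use nn q in auto)
    then show "\<sigma> ?KL u = (V K + V L) * c u"
      using KLc by (simp add: distrib_right)
  qed
  note cont' = radial_function_nonneg_continuous[OF K] radial_function_nonneg_continuous[OF L]
  \<comment> \<open>The weights \<open>V K\<close> and \<open>V L\<close> are the same for all
    directions, so a single function is annihilated in every direction; only the factor
    \<open>c u\<close> varies.\<close>
  let ?G = "\<lambda>v. convexity_gap (V K) (V L) ?p (?f v) (?g v)"
  have "\<Phi> ?G u = 0" if u: "u \<in> sphere 0 1" for u
  proof -
    interpret positive_functional "sphere 0 1" "\<lambda>f. \<Phi> f u"
      using u by (rule positive_functional_\<Phi>)
    show ?thesis
      by (rule minkowski_equality[where c = "c u"])
        (use cont' pos p c[OF u] in \<open>simp_all add: \<Phi>_radial_function_power[OF K u]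
          \<Phi>_radial_function_power[OF L u] \<sigma>_sum_power[OF K L u]\<close>)
  qed
  then have gap: "?G u = 0" if "u \<in> sphere 0 1" for u
    using \<Phi>_eq_0D[OF nontrivial convexity_gap_nonneg_continuous[OF cont' pos p(2)] _ that] by blast
  have "?f u = (V K / V L) * ?g u" if "u \<in> sphere 0 1" for u
  proof -
    have "?f u / V K = ?g u / V L"
      using convexity_gap(2)[OF pos _ _ p(1) gap[OF that]] nonneg_continuousD(2)[OF _ that] cont' by blast
    then show ?thesis using pos by (simp add: field_simps)
  qed
  then have "star_of ?f = star_of (\<lambda>u. V K / V L * ?g u)"
    by (rule star_of_cong)
  then have "K = star_of (\<lambda>u. V K / V L * ?g u)"
    by (simp only: star_of_radial_function[OF K])
  also have "\<dots> = (*\<^sub>R) (V K / V L) ` L"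
    using scaleR_image_star_of[of "V K / V L" ?g] pos by (simp add: star_of_radial_function[OF L])
  finally show ?thesis
    unfolding dilates_def using pos by (intro exI[of _ "V K / V L"]) simp
qed

text \<open>The radial function of the sum is \<open>c + 1\<close> times that of \<open>L\<close>,
  so both sides equal \<open>(c + 1) * V L\<close>.\<close>

lemma V_sum_dilate:
  assumes K: "K \<in> star_bodies" and L: "L \<in> star_bodies" and c: "0 \<le> c"
    and eq: "\<And>u. u \<in> sphere 0 1 \<Longrightarrow> radial_function K u = c * radial_function L u"
  shows "V (radial_minkowski_sum K L) = V K + V L"
proof -
  have "V (radial_minkowski_sum K L) = (c + 1) * V L"
    using c by (intro V_dilate radial_minkowski_sum(1) K L)
      (simp_all add: radial_minkowski_sum(2)[OF K L] eq distrib_right del: mem_sphere_0)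
  then show ?thesis
    using V_dilate[OF K L c eq] by (simp add: distrib_right)
qed

text \<open>Dilation factors are positive, so a pair with exactly one body \<open>{0}\<close> is not
  a pair of dilates although it gives equality; hence the extra alternatives.\<close>

lemma V_sum_eq_iff:
  assumes card3: "3 \<le> CARD('n)" and nontrivial: "\<not> trivial_hom \<Psi>"
    and K: "K \<in> star_bodies" and L: "L \<in> star_bodies"
  shows "V (radial_minkowski_sum K L) = V K + V L \<longleftrightarrow> dilates K L \<or> K = {0} \<or> L = {0}"
proof
  assume eq: "V (radial_minkowski_sum K L) = V K + V L"
  show "dilates K L \<or> K = {0} \<or> L = {0}"
  proof (cases "V K = 0 \<or> V L = 0")
    case True
    then show ?thesis using V_eq_0D[OF nontrivial] K L by blast
  next
    case False
    then have "0 < V K" "0 < V L" using V_nonneg[of K] V_nonneg[of L] by auto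
    then show ?thesis using V_sum_eqD[OF card3 nontrivial K L eq] by blast
  qed
next
  have zero: "radial_function {0} u = 0" if "u \<in> sphere 0 1" for u :: "real^'n"
    using radial_function_star_of[of "\<lambda>u. 0" u] that by (simp add: star_of_zero)
  have comm: "radial_minkowski_sum K L = radial_minkowski_sum L K"
    by (simp add: radial_minkowski_sum_def add.commute)
  assume "dilates K L \<or> K = {0} \<or> L = {0}"
  then consider c where "0 < c" "K = (*\<^sub>R) c ` L" | "K = {0}" | "L = {0}"
    by (auto simp: dilates_def)
  then show "V (radial_minkowski_sum K L) = V K + V L"
  proof cases
    case (1 c)
    then have "K = star_of (\<lambda>u. c * radial_function L u)"
      using scaleR_image_star_of[of c "radial_function L"] by (simp add: star_of_radial_function[OF L])
    then have "radial_function K u = c * radial_function L u" if "u \<in> sphere 0 1" for u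
      using that 1 radial_function_nonneg_continuous[OF L]
      by (simp add: radial_function_star_of_nonneg_continuous del: mem_sphere_0)
    then show ?thesis using 1 by (intro V_sum_dilate[OF K L, of c]) auto
  next
    case 2
    \<comment> \<open>The body \<open>{0}\<close> counts as the multiple of \<open>L\<close> with
      factor 0.\<close>
    then show ?thesis using V_sum_dilate[OF K L, of 0] zero by simp
  next
    case 3
    then show ?thesis using V_sum_dilate[OF L K, of 0] zero by (subst comm) (simp add: add.commute)
  qed
qed

end

theorem theorem1:
  fixes \<Psi> :: "(real^'n) set \<Rightarrow> (real^'n) set" and K L :: "(real^'n) set"
  assumes "CARD('n) \<ge> 3"
    and "radial_blaschke_minkowski_hom \<Psi>"
    and "\<not> trivial_hom \<Psi>"
    and "K \<in> star_bodies" and "L \<in> star_bodies"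
  shows "let p = 1 / (real CARD('n) * (real CARD('n) - 1)) in
      measure lebesgue (\<Psi> (radial_minkowski_sum K L)) powr p
        \<le> measure lebesgue (\<Psi> K) powr p + measure lebesgue (\<Psi> L) powr p \<and>
      (measure lebesgue (\<Psi> (radial_minkowski_sum K L)) powr p
        = measure lebesgue (\<Psi> K) powr p + measure lebesgue (\<Psi> L) powr p
       \<longleftrightarrow> dilates K L \<or> K = {0} \<or> L = {0})"
proof -
  interpret radial_hom \<Psi>
    using assms by unfold_locales auto
  show ?thesis
    unfolding Let_def using V_sum_le[OF assms(4,5)] V_sum_eq_iff[OF assms(1,3,4,5)]
    by (simp only: V_def simp_thms)
qed

end
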